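(* Let $K$ be a totally real cubic number field with ring of integers $\mathcal{O}_K$. If $K\neq\mathbb{Q}(\zeta_7+\zeta_7^{-1})$, then there does not exist a $\mathbb{Z}$-form that is universal over $\mathcal{O}_K$.
   Context: A $\mathbb{Z}$-form is a positive definite quadratic form $Q(x_1,\dots,x_r)=\sum_{1\le i\le j\le r}a_{ij}x_ix_j$ with all $a_{ij}\in\mathbb{Z}$. An element of $\mathcal{O}_K$ is totally positive if its image under each of the three real embeddings of $K$ is positive. A $\mathbb{Z}$-form $Q$ is universal over $\mathcal{O}_K$ if every totally positive $\alpha\in\mathcal{O}_K$ equals $Q(v)$ for some $v\in\mathcal{O}_K^r$. $\zeta_7$ denotes a primitive $7$th root of unity. *)

theory Defs
  imports Complex_Main "HOL-Computational_Algebra.Computational_Algebra"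
begin

definition rat_adjoin :: "real \<Rightarrow> real set" where
  "rat_adjoin \<theta> = {poly (map_poly of_rat q) \<theta> | q :: rat poly. True}"

definition totally_real_cubic_field :: "real set \<Rightarrow> bool" where
  "totally_real_cubic_field K \<longleftrightarrow>
     (\<exists>\<theta> (p :: rat poly). irreducible p \<and> degree p = 3 \<and>
        poly (map_poly of_rat p) \<theta> = 0 \<and>
        card {x :: real. poly (map_poly of_rat p) x = 0} = 3 \<and>
        K = rat_adjoin \<theta>)"

definition ring_of_integers :: "real set \<Rightarrow> real set" where
  "ring_of_integers K = {x \<in> K. algebraic_int x}"

text \<open>Real embeddings: ring homomorphisms K \<rightarrow> R (only values on K matter).\<close>
definition real_embedding :: "real set \<Rightarrow> (real \<Rightarrow> real) \<Rightarrow> bool" where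
  "real_embedding K \<sigma> \<longleftrightarrow> \<sigma> 1 = 1 \<and>
     (\<forall>x\<in>K. \<forall>y\<in>K. \<sigma> (x + y) = \<sigma> x + \<sigma> y \<and> \<sigma> (x * y) = \<sigma> x * \<sigma> y)"

definition totally_positive :: "real set \<Rightarrow> real \<Rightarrow> bool" where
  "totally_positive K x \<longleftrightarrow> x \<in> K \<and> (\<forall>\<sigma>. real_embedding K \<sigma> \<longrightarrow> \<sigma> x > 0)"

definition qf_eval :: "nat \<Rightarrow> (nat \<Rightarrow> nat \<Rightarrow> int) \<Rightarrow> (nat \<Rightarrow> real) \<Rightarrow> real" where
  "qf_eval r a v = (\<Sum>i<r. \<Sum>j\<in>{i..<r}. of_int (a i j) * v i * v j)"

definition Z_form :: "nat \<Rightarrow> (nat \<Rightarrow> nat \<Rightarrow> int) \<Rightarrow> bool" where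
  "Z_form r a \<longleftrightarrow> (\<forall>v :: nat \<Rightarrow> real. (\<exists>i<r. v i \<noteq> 0) \<longrightarrow> qf_eval r a v > 0)"

definition universal_over :: "real set \<Rightarrow> nat \<Rightarrow> (nat \<Rightarrow> nat \<Rightarrow> int) \<Rightarrow> bool" where
  "universal_over K r a \<longleftrightarrow>
     (\<forall>\<alpha> \<in> ring_of_integers K. totally_positive K \<alpha> \<longrightarrow>
        (\<exists>v. (\<forall>i<r. v i \<in> ring_of_integers K) \<and> qf_eval r a v = \<alpha>))"

end

(*
  For x in the ring of integers put q(x) = 1/2 * sum of (x_i - x_j)^2 over pairs of conjugates, an
  integer depending only on x modulo Z. Let theta minimise q on non-rational integers, with minimum m.
  If a Z-form Q represents a non-rational alpha = Q(v), write v = w0 + w1 theta + w2 eta in a q-reduced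
  basis; then 3 Tr alpha = Q(sum of the v_k) + sum of Q(v_k - v_l), and Q >= 1 on nonzero integer vectors
  forces 3 Tr alpha >= 2m, and even 3 Tr alpha >= 2m + 27/4 unless alpha is a square. On the other hand, a
  suitable translate k + theta or k - theta is totally positive and has trace of order sqrt(m) only.
  Comparing the two leaves finitely many minimal polynomials of theta: those of discriminant 81 and
  148 are excluded because the translate has norm 3 or 5, hence is not a square, and the only one left
  is that of -2 cos(2 pi / 7) up to conjugation.
*)
theory Submission
  imports Defs "Jordan_Normal_Form.Char_Poly"
begin

section \<open>Sums and products of algebraic integers\<close>

text \<open>The coefficients of Q are rational, so conjugation turns Q(v) into Q of the conjugate
  vectors v_k. The differences v_k - v_l lose w0, so only the binary form (b, c) -> Q(b w1 + c w2)
  gets paired with q. The bound 2m alone is too weak: for discriminant 81 the translate used has 3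
  Tr = 18 = 2m. The gain 27/4 comes from parity. If all coordinates of v lie in Z + Z psi, alpha is
  a binary form at (psi, 1); when its leading coefficient is 1, minus its discriminant is 0 or 3
  modulo 4, and is either 0, which makes alpha a square, or at least 3, which adds (9/4) * 3. In the
  remaining case 3 Tr alpha >= 3m, which reaches 2m + 27/4 once m >= 7; this is where the 7 comes
  from. For discriminant 49 the method has to stop: there m = 7, and 2 - theta = 2 + 2 cos(2 pi / 7)
  = (2 cos(pi / 7))^2 has trace 5, so 15 lies between 14 and 20.75, while the element is a
  square.\<close>

lemma algebraic_int_eigenvalue_of_int_mat:
  fixes y :: real
  assumes A: "A \<in> carrier_mat n n" and ev: "eigenvalue (map_mat of_int A) y"
  shows "algebraic_int y"
proof -
  have "poly (char_poly (map_mat of_int A)) y = 0"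
    using eigenvalue_root_char_poly[of "map_mat of_int A" n y] A ev by simp
  also have "char_poly (map_mat of_int A) = map_poly (of_int :: int \<Rightarrow> real) (char_poly A)"
    by (rule of_int_hom.char_poly_hom[OF A])
  finally have "poly (map_poly of_int (char_poly A)) y = 0" .
  thus ?thesis unfolding algebraic_int_altdef_ipoly
    using degree_monic_char_poly[OF A] by auto
qed

lemma algebraic_int_if_int_matrix:
  fixes y :: real and u :: "nat \<Rightarrow> real"
  assumes "\<exists>i<n. u i \<noteq> 0"
    and eq: "\<And>i. i < n \<Longrightarrow> y * u i = (\<Sum>j<n. of_int (A i j) * u j)"
  shows "algebraic_int y"
proof (rule algebraic_int_eigenvalue_of_int_mat)
  let ?A = "mat n n (\<lambda>(i, j). A i j)"
  show "?A \<in> carrier_mat n n" by simp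
  have "eigenvector (map_mat of_int ?A) (vec n u) y"
    unfolding eigenvector_def
  proof (intro conjI)
    obtain i where "i < n" "u i \<noteq> 0" using assms(1) by blast
    thus "vec n u \<noteq> 0\<^sub>v (dim_row (map_mat of_int ?A))"
      by (auto simp: vec_eq_iff)
    show "map_mat of_int ?A *\<^sub>v vec n u = y \<cdot>\<^sub>v vec n u"
      by (rule eq_vecI)
        (auto simp: eq scalar_prod_def mult.commute intro!: sum.cong simp flip: atLeast0LessThan)
  qed simp
  thus "eigenvalue (map_mat of_int ?A) y"
    unfolding eigenvalue_def by blast
qed

text \<open>The reals as a module over the integers: \<open>int_module.span\<close> is the set of
  integral linear combinations.\<close>

interpretation int_module: Modules.module "\<lambda>(k::int) (x::real). of_int k * x"
  by unfold_locales (auto simp: algebra_simps)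

text \<open>The determinant trick: multiplication by y acts on the span of B through an integer
  matrix, and the vector of elements of B is an eigenvector for y, nonzero because 1 occurs in
  it.\<close>

lemma algebraic_int_if_stable:
  fixes y :: real
  assumes "finite B" "1 \<in> B" and stable: "\<And>b. b \<in> B \<Longrightarrow> y * b \<in> int_module.span B"
  shows "algebraic_int y"
proof -
  obtain u where u: "bij_betw u {..<card B} B"
    using ex_bij_betw_nat_finite[OF assms(1)] by (auto simp: atLeast0LessThan)
  have "\<exists>c. y * b = (\<Sum>v\<in>B. of_int (c v) * v)" if "b \<in> B" for b
    using stable[OF that] int_module.span_finite[OF assms(1)] by auto
  then obtain c where c: "\<And>b. b \<in> B \<Longrightarrow> y * b = (\<Sum>v\<in>B. of_int (c b v) * v)"
    by metis
  show ?thesis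
  proof (rule algebraic_int_if_int_matrix)
    show "\<exists>i<card B. u i \<noteq> 0"
      using assms(2) u by (metis bij_betw_def imageE lessThan_iff zero_neq_one)
    show "y * u i = (\<Sum>j<card B. of_int (c (u i) (u j)) * u j)" if "i < card B" for i
    proof -
      have "y * u i = (\<Sum>v\<in>B. of_int (c (u i) v) * v)"
        using c u that by (meson bij_betwE lessThan_iff)
      also have "\<dots> = (\<Sum>j<card B. of_int (c (u i) (u j)) * u j)"
        using sum.reindex_bij_betw[OF u, of "\<lambda>v. of_int (c (u i) v) * v"] by simp
      finally show ?thesis .
    qed
  qed
qed

lemma int_span_stable:
  assumes "\<And>b. b \<in> B \<Longrightarrow> y * b \<in> int_module.span B" "z \<in> int_module.span B"
  shows "y * z \<in> int_module.span B"
  using assms(2)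
proof (induction rule: int_module.span_induct_alt)
  case base
  show ?case by (simp add: int_module.span_zero)
next
  case (step c x z)
  have "y * (of_int c * x + z) = of_int c * (y * x) + y * z"
    by (simp add: algebra_simps)
  thus ?case using step assms(1) int_module.span_add int_module.span_scale by metis
qed

lemma algebraic_int_power_reduction:
  fixes x :: real
  assumes "algebraic_int x"
  obtains m and c :: "nat \<Rightarrow> int" where "m > 0" "x ^ m = (\<Sum>i<m. of_int (c i) * x ^ i)"
proof -
  obtain p where p: "poly (map_poly of_int p) x = 0" "lead_coeff p = (1::int)"
    using assms unfolding algebraic_int_altdef_ipoly by blast
  have "degree p \<noteq> 0"
  proof
    assume "degree p = 0"
    then obtain a where "p = [:a:]" by (rule degree_eq_zeroE)
    thus False using p by simp
  qed
  moreover have "x ^ degree p = (\<Sum>i<degree p. of_int (- coeff p i) * x ^ i)"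
  proof -
    have "0 = (\<Sum>i\<le>degree p. of_int (coeff p i) * x ^ i)"
      using p(1) by (simp add: poly_altdef)
    also have "\<dots> = (\<Sum>i<degree p. of_int (coeff p i) * x ^ i) + x ^ degree p"
      using p(2) by (simp add: lessThan_Suc_atMost[symmetric])
    finally show ?thesis by (simp add: sum_negf)
  qed
  ultimately show thesis using that[of "degree p" "\<lambda>i. - coeff p i"] by auto
qed

text \<open>The monomials x^i y^j with i < m and j < n span a module containing 1 and stable under
  both x and y, because x^m and y^n reduce to lower powers. It is then stable under x + y and x
  y.\<close>

lemma
  fixes x y :: real
  assumes "algebraic_int x" "algebraic_int y"
  shows algebraic_int_add: "algebraic_int (x + y)"
    and algebraic_int_mult: "algebraic_int (x * y)"
proof -
  obtain m c where m: "m > 0" and x: "x ^ m = (\<Sum>i<m. of_int (c i) * x ^ i)"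
    using algebraic_int_power_reduction[OF assms(1)] by blast
  obtain n d where n: "n > 0" and y: "y ^ n = (\<Sum>i<n. of_int (d i) * y ^ i)"
    using algebraic_int_power_reduction[OF assms(2)] by blast
  define B where "B = {x ^ i * y ^ j | i j. i < m \<and> j < n}"
  have B: "x ^ i * y ^ j \<in> int_module.span B" if "i < m" "j < n" for i j
    using that by (auto intro!: int_module.span_base simp: B_def)
  have X: "x * b \<in> int_module.span B" if "b \<in> B" for b
  proof -
    obtain i j where ij: "i < m" "j < n" "b = x ^ i * y ^ j"
      using \<open>b \<in> B\<close> by (auto simp: B_def)
    have "x ^ Suc i * y ^ j \<in> int_module.span B"
    proof (cases "Suc i = m")
      case True
      have "x ^ Suc i * y ^ j = (\<Sum>k<m. of_int (c k) * (x ^ k * y ^ j))"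
        unfolding True x by (simp only: sum_distrib_right mult.assoc)
      also have "\<dots> \<in> int_module.span B"
        by (intro int_module.span_sum int_module.span_scale B ij) auto
      finally show ?thesis .
    next
      case False
      thus ?thesis using ij by (intro B) auto
    qed
    thus ?thesis by (simp add: ij mult_ac)
  qed
  have Y: "y * b \<in> int_module.span B" if "b \<in> B" for b
  proof -
    obtain i j where ij: "i < m" "j < n" "b = x ^ i * y ^ j"
      using \<open>b \<in> B\<close> by (auto simp: B_def)
    have "x ^ i * y ^ Suc j \<in> int_module.span B"
    proof (cases "Suc j = n")
      case True
      have "x ^ i * y ^ Suc j = (\<Sum>k<n. of_int (d k) * (x ^ i * y ^ k))"
        unfolding True y by (simp add: sum_distrib_left mult_ac)
      also have "\<dots> \<in> int_module.span B"
        by (intro int_module.span_sum int_module.span_scale B ij) auto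
      finally show ?thesis .
    next
      case False
      thus ?thesis using ij by (intro B) auto
    qed
    thus ?thesis by (simp add: ij mult_ac)
  qed
  have fin: "finite B" "1 \<in> B"
    using m n by (auto simp: B_def intro!: finite_image_set2 exI[of _ 0])
  show "algebraic_int (x + y)"
    by (rule algebraic_int_if_stable[OF fin])
      (auto simp: distrib_right intro!: int_module.span_add X Y)
  show "algebraic_int (x * y)"
    by (rule algebraic_int_if_stable[OF fin])
      (auto simp: mult.assoc intro!: int_span_stable[OF X] Y)
qed

section \<open>Real-rooted cubics with a small totally positive translate\<close>

text \<open>Used to choose the translation: the upper bound on N makes the translate totally
  positive, while failure at k - 1 bounds N from below and so keeps the trace, linear in k, small
  against N.\<close>

lemma exists_least_above:
  fixes N k0 b :: int
  assumes "k0 \<ge> 0" "b \<ge> 0" "k0 * (k0 + b) < N"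
  obtains k where "k > k0" "(k - 1) * (k - 1 + b) < N" "N \<le> k * (k + b)"
proof -
  define P where "P n \<longleftrightarrow> N \<le> (k0 + int n) * (k0 + int n + b)" for n
  have "0 \<le> k0 * (k0 + b)" using assms by simp
  hence "N > 0" using assms by linarith
  hence "N * 1 \<le> (k0 + N) * (k0 + N + b)" using assms by (intro mult_mono) auto
  hence "P (nat N)" using \<open>N > 0\<close> by (simp add: P_def)
  then obtain n where n: "P n" "\<And>i. i < n \<Longrightarrow> \<not> P i"
    using ex_least_nat_le[of P "nat N"] by blast
  have "n \<noteq> 0"
  proof
    assume "n = 0"
    thus False using n(1) assms(3) by (simp add: P_def)
  qed
  hence "\<not> P (n - 1)" using n(2) by simp
  hence "(k0 + int n - 1) * (k0 + int n - 1 + b) < N"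
    using \<open>n \<noteq> 0\<close> by (simp add: P_def of_nat_diff algebra_simps)
  thus thesis using that[of "k0 + int n"] n(1) \<open>n \<noteq> 0\<close> by (simp add: P_def)
qed

lemma prod_shift_three:
  fixes x y z w :: real
  shows "(x + w) * (y + w) * (z + w) = x * y * z + (x * y + y * z + z * x) * w + (x + y + z) * w\<^sup>2 + w ^ 3"
  unfolding power2_eq_square power3_eq_cube
  by (simp only: distrib_left distrib_right mult.assoc mult.commute mult.left_commute
      add.assoc add.commute add.left_commute)

text \<open>The roots of X^3 - A X^2 - N X - C. The sign of N makes the value of q equal to A^2 + 3
  N, so that N >= 0 once A is 0 or 1.\<close>

locale cubic_roots =
  fixes x y z :: real and A N C :: int
  assumes e1: "x + y + z = of_int A" and e2: "x * y + y * z + z * x = - of_int N"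
    and e3: "x * y * z = of_int C"
    and nonint: "x \<notin> \<int>" "y \<notin> \<int>" "z \<notin> \<int>"
begin

lemma shift_norm: "(x + of_int k) * (y + of_int k) * (z + of_int k) = of_int (C - N * k + A * k\<^sup>2 + k ^ 3)"
  unfolding prod_shift_three e1 e2 e3 by simp

text \<open>The left side is the cubic at n, up to sign the product of the differences between roots
  and n. It discards the reducible cubics that survive the discriminant bound.\<close>

lemma eval_neq_0: "n ^ 3 - A * n\<^sup>2 - N * n - C \<noteq> 0"
proof
  assume "n ^ 3 - A * n\<^sup>2 - N * n - C = 0"
  hence "C - N * (- n) + A * (- n)\<^sup>2 + (- n) ^ 3 = 0" by simp
  hence "(x + of_int (- n)) * (y + of_int (- n)) * (z + of_int (- n)) = 0"
    unfolding shift_norm by simp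
  hence "x = of_int n \<or> y = of_int n \<or> z = of_int n" by simp
  thus False using nonint by (metis Ints_of_int)
qed

text \<open>This is the discriminant of the cubic, the square of the Vandermonde product of its real
  roots. For given N it leaves finitely many C.\<close>

lemma discriminant_nonneg:
  "A\<^sup>2 * N\<^sup>2 + 4 * N ^ 3 - 4 * A ^ 3 * C - 27 * C\<^sup>2 - 18 * A * N * C \<ge> 0"
proof -
  have N: "real_of_int N = - (x * y + y * z + z * x)" using e2 by simp
  have "real_of_int (A\<^sup>2 * N\<^sup>2 + 4 * N ^ 3 - 4 * A ^ 3 * C - 27 * C\<^sup>2 - 18 * A * N * C) =
      ((x - y) * (y - z) * (z - x))\<^sup>2"
    unfolding of_int_add of_int_diff of_int_mult of_int_power of_int_numeral N
    unfolding e1[symmetric] e3[symmetric]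
    by (simp add: power2_eq_square power3_eq_cube algebra_simps)
  hence "real_of_int (A\<^sup>2 * N\<^sup>2 + 4 * N ^ 3 - 4 * A ^ 3 * C - 27 * C\<^sup>2 - 18 * A * N * C) \<ge> 0" by simp
  thus ?thesis by (simp only: of_int_0_le_iff)
qed

lemma q_nonneg: "A\<^sup>2 + 3 * N \<ge> 0"
proof -
  have "2 * real_of_int (A\<^sup>2 + 3 * N) = (x - y)\<^sup>2 + (y - z)\<^sup>2 + (z - x)\<^sup>2"
    using e2 by (simp flip: e1 add: power2_eq_square algebra_simps)
  hence "real_of_int (A\<^sup>2 + 3 * N) \<ge> 0" 
    by (smt (verit) zero_le_power2)
  thus ?thesis by (simp only: of_int_0_le_iff)
qed

text \<open>Each form eliminates two of the roots except for their product, whose sign is known from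
  \<open>e3\<close> once the sign of the third root is.\<close>

lemma N_eq: 
  "of_int N = x\<^sup>2 - of_int A * x - y * z" 
  "of_int N = y\<^sup>2 - of_int A * y - z * x"
  "of_int N = z\<^sup>2 - of_int A * z - x * y"
  using e2 by (simp_all flip: e1 add: power2_eq_square algebra_simps)

text \<open>If \<open>x < 0 < C\<close> then \<open>y * z < 0\<close>, so \<open>N = x\<^sup>2 - A x - y z\<close> exceeds \<open>x\<^sup>2 - A x\<close>.\<close>

lemma add_pos:
  fixes k :: int
  assumes "C > 0" "A \<ge> 0" "k > 0" "N \<le> k * (k + A)"
  shows "x + of_int k > 0" "y + of_int k > 0" "z + of_int k > 0"
proof -
  have main: "u + of_int k > 0"
    if u: "u * w = of_int C" "of_int N = u\<^sup>2 - of_int A * u - w" for u w :: real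
  proof (rule ccontr)
    assume "\<not> u + of_int k > 0"
    hence uk: "- u \<ge> of_int k" by simp
    hence "u < 0" using \<open>k > 0\<close> by (smt (verit) of_int_pos)
    moreover have "u * w > 0" using u(1) \<open>C > 0\<close> by simp
    ultimately have "w < 0" by (simp add: zero_less_mult_iff)
    have "of_int k * (of_int k + of_int A) \<le> (- u) * (- u + of_int A)"
      using uk assms by (intro mult_mono) auto
    hence "real_of_int (k * (k + A)) < of_int N" 
      using \<open>w < 0\<close> u(2) by (simp add: power2_eq_square algebra_simps)
    thus False using assms(4) by (simp only: of_int_less_iff)
  qed
  show "x + of_int k > 0" by (rule main[OF _ N_eq(1)]) (use e3 in \<open>simp add: mult_ac\<close>)
  show "y + of_int k > 0" by (rule main[OF _ N_eq(2)]) (use e3 in \<open>simp add: mult_ac\<close>)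
  show "z + of_int k > 0" by (rule main[OF _ N_eq(3)]) (use e3 in \<open>simp add: mult_ac\<close>)
qed

text \<open>Mirror image of \<open>add_pos\<close>: a root u >= k > 0 has a negative cofactor w
  because u w = C < 0, and then N = u^2 - u - w exceeds k (k - 1).\<close>

lemma diff_pos:
  fixes k :: int
  assumes "C < 0" "A = 1" "k \<ge> 1" "N \<le> k * (k - 1)"
  shows "of_int k - x > 0" "of_int k - y > 0" "of_int k - z > 0"
proof -
  have main: "of_int k - u > 0"
    if u: "u * w = of_int C" "of_int N = u\<^sup>2 - of_int A * u - w" for u w :: real
  proof (rule ccontr)
    assume "\<not> of_int k - u > 0"
    hence uk: "u \<ge> of_int k" by simp
    hence "u > 0" using \<open>k \<ge> 1\<close> by (smt (verit) of_int_1_le_iff)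
    moreover have "u * w < 0" using u(1) \<open>C < 0\<close> by simp
    ultimately have "w < 0" by (simp add: mult_less_0_iff)
    have "of_int k * (of_int k - 1) \<le> u * (u - 1)"
      using uk assms \<open>u > 0\<close> by (intro mult_mono) auto
    hence "real_of_int (k * (k - 1)) < of_int N" 
      using \<open>w < 0\<close> u(2) \<open>A = 1\<close> by (simp add: power2_eq_square algebra_simps)
    thus False using assms(4) by (simp only: of_int_less_iff)
  qed
  show "of_int k - x > 0" by (rule main[OF _ N_eq(1)]) (use e3 in \<open>simp add: mult_ac\<close>)
  show "of_int k - y > 0" by (rule main[OF _ N_eq(2)]) (use e3 in \<open>simp add: mult_ac\<close>)
  show "of_int k - z > 0" by (rule main[OF _ N_eq(3)]) (use e3 in \<open>simp add: mult_ac\<close>)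
qed

text \<open>The number \<open>\<epsilon> x + k\<close> with the given conjugates is totally positive and its trace is too small
  for it to be represented. In the second case it could still be a square, which its norm excludes;
  this is needed only for the fields of discriminant 81 and 148.\<close>

definition good_shift :: "real \<Rightarrow> int \<Rightarrow> bool" where
  "good_shift \<epsilon> k \<longleftrightarrow> \<epsilon> * x + of_int k > 0 \<and> \<epsilon> * y + of_int k > 0 \<and> \<epsilon> * z + of_int k > 0 \<and>
     (3 * (\<epsilon> * of_int A + 3 * of_int k) < 2 * of_int (A\<^sup>2 + 3 * N) \<or>
      3 * (\<epsilon> * of_int A + 3 * of_int k) < 2 * of_int (A\<^sup>2 + 3 * N) + (27/4 :: real) \<and>
      (\<epsilon> * x + of_int k) * (\<epsilon> * y + of_int k) * (\<epsilon> * z + of_int k) \<in> {3, 5})"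

lemma good_shift_trace_0:
  assumes "A = 0" "C > 0"
  shows "7 \<le> A\<^sup>2 + 3 * N \<and> (\<exists>k. good_shift 1 k)"
proof -
  have disc: "27 * (C * C) \<le> 4 * N ^ 3"
    using discriminant_nonneg assms by (simp add: power2_eq_square)
  have CC: "C * C \<ge> 1" using mult_mono[of 1 C 1 C] assms by simp
  have "N \<ge> 0" using q_nonneg assms by simp
  consider "N \<le> 1" | "N = 2" | "N = 3" | "N = 4" | "N \<ge> 5" by linarith
  thus ?thesis
  proof cases
    case 1
    hence "N ^ 3 \<le> 1 ^ 3" using \<open>N \<ge> 0\<close> by (intro power_mono) auto
    hence False using disc CC by simp
    thus ?thesis ..
  next
    case 2
    have "C < 2" using disc 2 mult_mono[of 2 C 2 C] by fastforce
    hence "C = 1" using assms by simp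
    thus ?thesis using eval_neq_0[of "-1"] assms 2 by simp
  next
    case 3
    have "C < 3" using disc 3 mult_mono[of 3 C 3 C] by fastforce
    moreover have "C \<noteq> 2" using eval_neq_0[of "-1"] assms 3 by auto
    ultimately have "C = 1" using assms by linarith
    \<comment> \<open>The cubic X^3 - 3 X - 1 of discriminant 81: here 3 * 6 equals 2 * 9, so the
      strict trace bound fails and the norm 8 - 6 + 1 = 3 has to serve.\<close>
    have "good_shift 1 2"
      unfolding good_shift_def using add_pos[of 2] shift_norm[of 2] assms 3 \<open>C = 1\<close> by simp
    thus ?thesis using 3 assms by auto
  next
    case 4
    have "good_shift 1 2"
      unfolding good_shift_def using add_pos[of 2] assms 4 by simp
    thus ?thesis using 4 assms by auto
  next
    case 5
    then obtain k where k: "k > 2" "(k - 1) * (k - 1 + 0) < N" "N \<le> k * (k + 0)"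
      by (rule_tac exists_least_above[of 2 0 N]) auto
    \<comment> \<open>This is the trace condition for A = 0. At k = 3 it needs N >= 5; for k >= 4 it
      follows from N > (k - 1)^2 >= 2 k + 1.\<close>
    have "9 * k < 6 * N"
    proof (cases "k = 3")
      case False
      hence "k * k \<ge> 4 * k" using k by (intro mult_right_mono) auto
      moreover have "(k - 1) * (k - 1 + 0) = k * k - 2 * k + 1" by (simp add: algebra_simps)
      ultimately show ?thesis using k by linarith
    qed (use k in simp)
    hence "9 * real_of_int k < 6 * of_int N" by linarith
    hence "good_shift 1 k"
      unfolding good_shift_def using add_pos[of k] assms k by simp
    thus ?thesis using 5 assms by auto
  qed
qed

text \<open>The discriminant and the root -1 of X^3 - X^2 - 3 X - 1 eliminate all N <= 3; from N = 4
  on the trace alone suffices.\<close>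

lemma good_shift_trace_1_pos:
  assumes "A = 1" "C > 0"
  shows "7 \<le> A\<^sup>2 + 3 * N \<and> (\<exists>k. good_shift 1 k)"
proof -
  have disc: "27 * (C * C) + 4 * C + 18 * N * C \<le> N\<^sup>2 + 4 * N ^ 3"
    using discriminant_nonneg assms by (simp add: power2_eq_square)
  have CC: "C * C \<ge> 1" using mult_mono[of 1 C 1 C] assms by simp
  have "N \<ge> 0" using q_nonneg assms by simp
  consider "N \<le> 1" | "N = 2" | "N = 3" | "N \<in> {4..6}" | "N \<ge> 7" by fastforce
  thus ?thesis
  proof cases
    case 1
    hence "N ^ 3 \<le> 1 ^ 3" "N\<^sup>2 \<le> 1\<^sup>2" using \<open>N \<ge> 0\<close> by (intro power_mono; simp)+
    moreover have "0 \<le> 18 * N * C" using \<open>N \<ge> 0\<close> assms by simp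
    ultimately have False using disc CC assms by simp
    thus ?thesis ..
  next
    case 2
    thus ?thesis using disc assms CC by auto
  next
    case 3
    have "C < 2" using disc 3 mult_mono[of 2 C 2 C] by fastforce
    hence "C = 1" using assms by simp
    thus ?thesis using eval_neq_0[of "-1"] assms 3 by simp
  next
    case 4
    hence "real_of_int N \<ge> 4" by simp
    hence "good_shift 1 2"
      unfolding good_shift_def using add_pos[of 2] assms 4 by simp
    thus ?thesis using 4 assms by auto
  next
    case 5
    then obtain k where k: "k > 2" "(k - 1) * (k - 1 + 1) < N" "N \<le> k * (k + 1)"
      by (rule_tac exists_least_above[of 2 1 N]) auto
    have "9 * k + 1 < 6 * N"
    proof (cases "k = 3")
      case False
      hence "k * k \<ge> 4 * k" using k by (intro mult_right_mono) auto
      moreover have "(k - 1) * (k - 1 + 1) = k * k - k" by (simp add: algebra_simps)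
      ultimately show ?thesis using k by linarith
    qed (use k in simp)
    hence "9 * real_of_int k + 1 < 6 * of_int N" by linarith
    hence "good_shift 1 k"
      unfolding good_shift_def using add_pos[of k] assms k by simp
    thus ?thesis using 5 assms by auto
  qed
qed

text \<open>For N <= 3 only two irreducible cubics remain: N = 2, C = -1 of discriminant 49, the
  exception, and N = 3, C = -1 of discriminant 148. From N = 4 on the translates are k - x.\<close>

lemma good_shift_trace_1_neg:
  assumes "A = 1" "C < 0"
  shows "N = 2 \<and> C = -1 \<or> 7 \<le> A\<^sup>2 + 3 * N \<and> (\<exists>\<epsilon>\<in>{1, -1}. \<exists>k. good_shift \<epsilon> k)"
proof -
  define c where "c = - C"
  have C: "C = - c" and "c \<ge> 1" using assms by (auto simp: c_def)
  have disc: "27 * (c * c) \<le> N\<^sup>2 + 4 * N ^ 3 + 4 * c + 18 * N * c"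
    using discriminant_nonneg assms by (simp add: power2_eq_square C)
  have mono: "c * c \<ge> d * c" if "c \<ge> d" for d using \<open>c \<ge> 1\<close> that by (intro mult_right_mono) auto
  have "N \<ge> 0" using q_nonneg assms by simp
  consider "N = 0" | "N = 1" | "N = 2" | "N = 3" | "N \<in> {4..6}" | "N \<ge> 7" 
    using \<open>N \<ge> 0\<close> by fastforce
  thus ?thesis
  proof cases
    case 1
    thus ?thesis using disc mono[of 1] \<open>c \<ge> 1\<close> by simp
  next
    case 2
    have "c < 2" using disc 2 mono[of 2] by fastforce
    hence "c = 1" using \<open>c \<ge> 1\<close> by simp
    thus ?thesis using eval_neq_0[of 1] assms 2 by (simp add: C)
  next
    case 3
    have "c < 3" using disc 3 mono[of 3] by fastforce
    moreover have "c \<noteq> 2" using eval_neq_0[of 1] assms 3 by (auto simp: C)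
    ultimately have "c = 1" using \<open>c \<ge> 1\<close> by simp
    thus ?thesis using 3 by (simp add: C)
  next
    case 4
    have "c < 4" using disc 4 mono[of 4] by fastforce
    moreover have "c \<noteq> 2" using eval_neq_0[of 2] assms 4 by (auto simp: C)
    moreover have "c \<noteq> 3" using eval_neq_0[of 1] assms 4 by (auto simp: C)
    ultimately have "c = 1" using \<open>c \<ge> 1\<close> by simp
    \<comment> \<open>Since C < 0, \<open>add_pos\<close> does not apply. Instead u <= -2 would
      force the product of the other two roots to be at least 3, and then the norm would be at least
      6 in absolute value. The translate by 2 has norm 5.\<close>
    have pos: "u + 2 > 0" if u: "u * w = of_int C" "of_int N = u\<^sup>2 - of_int A * u - w" for u w :: real
    proof (rule ccontr)
      assume "\<not> u + 2 > 0"
      hence "- u \<ge> 2" by simp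
      hence "2 * (2 + 1) \<le> (- u) * (- u + 1)" by (intro mult_mono) auto
      hence w: "w \<ge> 3" using u(2) 4 assms by (simp add: power2_eq_square algebra_simps)
      have "2 * 3 \<le> (- u) * w" using \<open>- u \<ge> 2\<close> w by (intro mult_mono) auto
      thus False using u(1) \<open>c = 1\<close> by (simp add: C)
    qed
    have "x + 2 > 0" by (rule pos[OF _ N_eq(1)]) (use e3 in \<open>simp add: mult_ac\<close>)
    moreover have "y + 2 > 0" by (rule pos[OF _ N_eq(2)]) (use e3 in \<open>simp add: mult_ac\<close>)
    moreover have "z + 2 > 0" by (rule pos[OF _ N_eq(3)]) (use e3 in \<open>simp add: mult_ac\<close>)
    ultimately have "good_shift 1 2"
      unfolding good_shift_def using shift_norm[of 2] assms 4 \<open>c = 1\<close> by (simp add: C)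
    thus ?thesis using 4 assms by auto
  next
    case 5
    hence "real_of_int N \<ge> 4" by simp
    hence "good_shift (-1) 3"
      unfolding good_shift_def using diff_pos[of 3] assms 5 by simp
    thus ?thesis using 5 assms by auto
  next
    case 6
    then obtain k' where k': "k' > 2" "(k' - 1) * (k' - 1 + 1) < N" "N \<le> k' * (k' + 1)"
      by (rule_tac exists_least_above[of 2 1 N]) auto
    \<comment> \<open>The shift by one turns N <= k' (k' + 1) into the bound N <= k (k - 1) required
      by \<open>diff_pos\<close>.\<close>
    define k where "k = k' + 1"
    have k: "k > 3" "(k - 2) * (k - 1) < N" "N \<le> k * (k - 1)"
      using k' by (simp_all add: k_def algebra_simps)
    have "9 * k - 5 < 6 * N"
    proof (cases "k = 4")
      case False
      hence "k * k \<ge> 5 * k" using k by (intro mult_right_mono) auto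
      moreover have "(k - 2) * (k - 1) = k * k - 3 * k + 2" by (simp add: algebra_simps)
      ultimately show ?thesis using k by linarith
    qed (use k in simp)
    hence "9 * real_of_int k - 5 < 6 * of_int N" by linarith
    hence "good_shift (-1) k"
      unfolding good_shift_def using diff_pos[of k] assms k by simp
    thus ?thesis using 6 assms by auto
  qed
qed

end

lemma cubic_roots_good_shift:
  assumes "cubic_roots x y z A N C" "A \<in> {0, 1}"
  shows "A = 1 \<and> N = 2 \<and> C = -1 \<or>
    7 \<le> A\<^sup>2 + 3 * N \<and> (\<exists>\<epsilon>\<in>{1, -1}. \<exists>k. cubic_roots.good_shift x y z A N \<epsilon> k)"
proof -
  interpret cubic_roots x y z A N C by fact
  have "C \<noteq> 0" using eval_neq_0[of 0] by simp
  consider "A = 0" "C > 0" | "A = 0" "C < 0" | "A = 1" "C > 0" | "A = 1" "C < 0"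
    using assms(2) \<open>C \<noteq> 0\<close> by force
  thus ?thesis
  proof cases
    case 2
    \<comment> \<open>For A = 0, negating the roots changes only the sign of C, and a translate of
      -x with sign 1 is one of x with sign -1.\<close>
    interpret neg: cubic_roots "-x" "-y" "-z" A N "-C"
      by unfold_locales (use e1 e2 e3 nonint 2 in auto)
    obtain k where "7 \<le> A\<^sup>2 + 3 * N" "neg.good_shift 1 k" 
      using neg.good_shift_trace_0 2 by auto
    moreover from this(2) have "good_shift (-1) k"
      unfolding good_shift_def neg.good_shift_def using 2 by simp
    ultimately show ?thesis by auto
  qed (use good_shift_trace_0 good_shift_trace_1_pos good_shift_trace_1_neg in auto)
qed

section \<open>Totally real cubic fields\<close>

(* keeps the conjugate s 1 x from being rewritten to s (Suc 0) x *)
declare One_nat_def [simp del]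

lemma sum_three_squares_eq_0:
  fixes a b c :: real
  assumes "a\<^sup>2 + b\<^sup>2 + c\<^sup>2 = 0"
  shows "a = 0 \<and> b = 0 \<and> c = 0"
  using assms by (smt (verit) zero_eq_power2 zero_le_power2)

text \<open>A cubic field given by a power basis 1, t, t^2 with t integral, and by its conjugations
  \<open>s 0\<close>, \<open>s 1\<close>, \<open>s 2\<close>. By \<open>embedding_eq\<close> every
  real embedding is one of these three, so positivity of the three conjugates yields total
  positivity.\<close>

locale cubic_field =
  fixes K :: "real set" and t :: real and s :: "nat \<Rightarrow> real \<Rightarrow> real"
  assumes mem_K_iff: "x \<in> K \<longleftrightarrow> (\<exists>a\<in>\<rat>. \<exists>b\<in>\<rat>. \<exists>c\<in>\<rat>. x = a + b * t + c * t\<^sup>2)"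
    and coords_zero: "\<lbrakk>a \<in> \<rat>; b \<in> \<rat>; c \<in> \<rat>; a + b * t + c * t\<^sup>2 = 0\<rbrakk> \<Longrightarrow> a = 0 \<and> b = 0 \<and> c = 0"
    and mult_K: "\<lbrakk>x \<in> K; y \<in> K\<rbrakk> \<Longrightarrow> x * y \<in> K"
    and s_add: "\<lbrakk>x \<in> K; y \<in> K\<rbrakk> \<Longrightarrow> s i (x + y) = s i x + s i y"
    and s_mult: "\<lbrakk>x \<in> K; y \<in> K\<rbrakk> \<Longrightarrow> s i (x * y) = s i x * s i y"
    and s_Rats: "x \<in> \<rat> \<Longrightarrow> s i x = x"
    and s_inj: "\<lbrakk>x \<in> K; s i x = 0\<rbrakk> \<Longrightarrow> x = 0"
    and embedding_eq: "real_embedding K \<sigma> \<Longrightarrow> \<exists>i<3. \<forall>x\<in>K. \<sigma> x = s i x"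
    and trace_Rats: "x \<in> K \<Longrightarrow> s 0 x + s 1 x + s 2 x \<in> \<rat>"
    and algebraic_int_t: "algebraic_int t"
begin

abbreviation OK :: "real set" where "OK \<equiv> ring_of_integers K"

section \<open>Symmetric functions of the conjugates and the form q\<close>

definition tr :: "real \<Rightarrow> real" where "tr x = s 0 x + s 1 x + s 2 x"
definition e2 :: "real \<Rightarrow> real" where "e2 x = s 0 x * s 1 x + s 1 x * s 2 x + s 2 x * s 0 x"
definition nm :: "real \<Rightarrow> real" where "nm x = s 0 x * s 1 x * s 2 x"

definition q :: "real \<Rightarrow> real" where
  "q x = ((s 0 x - s 1 x)\<^sup>2 + (s 1 x - s 2 x)\<^sup>2 + (s 2 x - s 0 x)\<^sup>2) / 2"

definition qpolar :: "real \<Rightarrow> real \<Rightarrow> real" where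
  "qpolar x y = (s 0 x - s 1 x) * (s 0 y - s 1 y) + (s 1 x - s 2 x) * (s 1 y - s 2 y)
     + (s 2 x - s 0 x) * (s 2 y - s 0 y)"

lemma Rats_K: "x \<in> \<rat> \<Longrightarrow> x \<in> K"
  unfolding mem_K_iff by (rule bexI[of _ x], rule bexI[of _ 0], rule bexI[of _ 0]) auto

lemma Ints_K: "x \<in> \<int> \<Longrightarrow> x \<in> K"
  by (intro Rats_K) (meson Ints_subset_Rats subsetD)

lemma t_K: "t \<in> K"
  unfolding mem_K_iff by (rule bexI[of _ 0], rule bexI[of _ 1], rule bexI[of _ 0]) auto

lemma add_K: 
  assumes "x \<in> K" "y \<in> K"
  shows "x + y \<in> K"
proof -
  obtain a b c where abc: "a \<in> \<rat>" "b \<in> \<rat>" "c \<in> \<rat>" "x = a + b * t + c * t\<^sup>2"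
    using assms(1) mem_K_iff by blast
  obtain a' b' c' where abc': "a' \<in> \<rat>" "b' \<in> \<rat>" "c' \<in> \<rat>" "y = a' + b' * t + c' * t\<^sup>2"
    using assms(2) mem_K_iff by blast
  have "x + y = (a + a') + (b + b') * t + (c + c') * t\<^sup>2"
    by (simp add: abc abc' algebra_simps)
  thus ?thesis unfolding mem_K_iff using abc abc' by (meson Rats_add)
qed

lemma uminus_K: "x \<in> K \<Longrightarrow> - x \<in> K"
  using mult_K[of "-1" x] Rats_K[of "-1"] by simp

lemma diff_K: "\<lbrakk>x \<in> K; y \<in> K\<rbrakk> \<Longrightarrow> x - y \<in> K"
  using add_K[of x "- y"] uminus_K by simp

lemma power_K: "x \<in> K \<Longrightarrow> x ^ n \<in> K"
  by (induction n) (auto intro: mult_K Rats_K)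

lemma s_uminus: "x \<in> K \<Longrightarrow> s i (- x) = - s i x"
  using s_mult[of "-1" x i] Rats_K[of "-1"] s_Rats[of "-1" i] by simp

lemma s_diff: "\<lbrakk>x \<in> K; y \<in> K\<rbrakk> \<Longrightarrow> s i (x - y) = s i x - s i y"
  using s_add[of x "- y" i] uminus_K[of y] s_uminus[of y i] by simp

lemma s_power: "x \<in> K \<Longrightarrow> s i (x ^ n) = s i x ^ n"
  by (induction n) (auto simp: s_mult power_K s_Rats)

lemma s_eq_imp_eq: "\<lbrakk>x \<in> K; y \<in> K; s i x = s i y\<rbrakk> \<Longrightarrow> x = y"
  using s_inj[of "x - y" i] by (simp add: diff_K s_diff)

lemma s_poly_of_int: 
  assumes "x \<in> K"
  shows "poly (map_poly of_int p) x \<in> K \<and> s i (poly (map_poly of_int p) x) = poly (map_poly of_int p) (s i x)"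
  using assms
  by (induction p) (auto simp: map_poly_pCons s_Rats s_add s_mult add_K mult_K Rats_K)

lemma algebraic_int_s: 
  assumes "x \<in> OK"
  shows "algebraic_int (s i x)"
proof -
  have x: "x \<in> K" "algebraic_int x" using assms by (auto simp: ring_of_integers_def)
  obtain p where p: "poly (map_poly of_int p) x = 0" "lead_coeff p = (1::int)"
    using x(2) unfolding algebraic_int_altdef_ipoly by blast
  have "poly (map_poly of_int p) (s i x) = 0"
    using s_poly_of_int[OF x(1), of p i] p(1) s_Rats[of 0 i] by simp
  thus ?thesis using p(2) unfolding algebraic_int_altdef_ipoly by blast
qed

lemma O_K: "x \<in> OK \<Longrightarrow> x \<in> K"
  by (simp add: ring_of_integers_def)

lemma Ints_O: "x \<in> \<int> \<Longrightarrow> x \<in> OK"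
  by (simp add: ring_of_integers_def Ints_K int_imp_algebraic_int)

lemma add_O: "\<lbrakk>x \<in> OK; y \<in> OK\<rbrakk> \<Longrightarrow> x + y \<in> OK"
  by (simp add: ring_of_integers_def add_K algebraic_int_add)

lemma mult_O: "\<lbrakk>x \<in> OK; y \<in> OK\<rbrakk> \<Longrightarrow> x * y \<in> OK"
  by (simp add: ring_of_integers_def mult_K algebraic_int_mult)

lemma uminus_O: "x \<in> OK \<Longrightarrow> - x \<in> OK"
  by (simp add: ring_of_integers_def uminus_K)

lemma diff_O: "\<lbrakk>x \<in> OK; y \<in> OK\<rbrakk> \<Longrightarrow> x - y \<in> OK"
  using add_O[of x "- y"] uminus_O by simp

lemma t_O: "t \<in> OK"
  by (simp add: ring_of_integers_def t_K algebraic_int_t)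

lemma Rats_O: "\<lbrakk>x \<in> OK; x \<in> \<rat>\<rbrakk> \<Longrightarrow> x \<in> \<int>"
  by (simp add: ring_of_integers_def rational_algebraic_int_is_int)

lemma tr_Rats: "x \<in> K \<Longrightarrow> tr x \<in> \<rat>"
  unfolding tr_def by (rule trace_Rats)

text \<open>Newton's identities reduce the other symmetric functions to traces of powers, here and
  for \<open>nm\<close>.\<close>

lemma e2_Rats: 
  assumes "x \<in> K" shows "e2 x \<in> \<rat>"
proof -
  have eq: "e2 x = (tr x ^ 2 - tr (x ^ 2)) / 2"
    unfolding e2_def tr_def s_power[OF assms] by (simp add: field_simps power2_eq_square)
  show ?thesis unfolding eq using tr_Rats[of x] tr_Rats[of "x ^ 2"] power_K assms by simp
qed

lemma nm_Rats: 
  assumes "x \<in> K" shows "nm x \<in> \<rat>"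
proof -
  have eq: "nm x = (tr x ^ 3 - 3 * tr x * tr (x ^ 2) + 2 * tr (x ^ 3)) / 6"
    unfolding nm_def tr_def s_power[OF assms] by (simp add: field_simps power2_eq_square power3_eq_cube)
  show ?thesis unfolding eq using tr_Rats[of x] tr_Rats[of "x ^ 2"] tr_Rats[of "x ^ 3"] power_K assms by simp
qed

lemma 
  assumes "x \<in> OK" 
  shows tr_Ints: "tr x \<in> \<int>" and e2_Ints: "e2 x \<in> \<int>" and nm_Ints: "nm x \<in> \<int>"
proof -
  note * = algebraic_int_s[OF assms] O_K[OF assms]
  show "tr x \<in> \<int>" using * tr_Rats
    by (intro rational_algebraic_int_is_int) (auto simp: tr_def intro!: algebraic_int_add algebraic_int_mult)
  show "e2 x \<in> \<int>" using * e2_Rats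
    by (intro rational_algebraic_int_is_int) (auto simp: e2_def intro!: algebraic_int_add algebraic_int_mult)
  show "nm x \<in> \<int>" using * nm_Rats
    by (intro rational_algebraic_int_is_int) (auto simp: nm_def intro!: algebraic_int_add algebraic_int_mult)
qed

lemma q_eq: "q x = tr x ^ 2 - 3 * e2 x"
  unfolding q_def tr_def e2_def by (simp add: power2_eq_square field_simps)

lemma q_Ints: "x \<in> OK \<Longrightarrow> q x \<in> \<int>"
  unfolding q_eq using tr_Ints e2_Ints by simp

lemma q_nonneg: "q x \<ge> 0"
  unfolding q_def by simp

lemma q_comb:
  assumes "x \<in> K" "y \<in> K" "a \<in> \<rat>" "b \<in> \<rat>" "c \<in> \<rat>"
  shows "q (a + b * x + c * y) = b\<^sup>2 * q x + b * c * qpolar x y + c\<^sup>2 * q y"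
proof -
  have *: "s i (a + b * x + c * y) = a + b * s i x + c * s i y" for i
    using assms by (simp add: s_add s_mult s_Rats add_K mult_K Rats_K)
  show ?thesis unfolding q_def qpolar_def * by (simp add: power2_eq_square field_simps)
qed

lemma q_eq_0_imp_Rats:
  assumes "x \<in> K" "q x = 0"
  shows "x \<in> \<rat>"
proof -
  have "(s 0 x - s 1 x)\<^sup>2 + (s 1 x - s 2 x)\<^sup>2 + (s 2 x - s 0 x)\<^sup>2 = 0"
    using assms(2) by (simp add: q_def)
  hence "s 0 x - s 1 x = 0" "s 1 x - s 2 x = 0"
    using sum_three_squares_eq_0 by blast+
  hence "s 0 x = tr x / 3" by (simp add: tr_def)
  moreover have "tr x / 3 \<in> \<rat>" using tr_Rats[OF assms(1)] by simp
  ultimately have "x = tr x / 3"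
    using s_eq_imp_eq[OF assms(1), of "tr x / 3" 0] by (simp add: Rats_K s_Rats)
  thus ?thesis using \<open>tr x / 3 \<in> \<rat>\<close> by (rule ssubst)
qed

section \<open>Rational coordinates and a reduced basis of the integers\<close>

lemma coords_unique:
  assumes "a \<in> \<rat>" "b \<in> \<rat>" "c \<in> \<rat>" "a' \<in> \<rat>" "b' \<in> \<rat>" "c' \<in> \<rat>"
    and "a + b * t + c * t\<^sup>2 = a' + b' * t + c' * t\<^sup>2"
  shows "a = a' \<and> b = b' \<and> c = c'"
  using coords_zero[of "a - a'" "b - b'" "c - c'"] assms by (simp add: algebra_simps)

text \<open>Cramer's rule: D is the determinant of the coordinates of x and y along t and t^2, and D
  = 0 would put y into Q + Q x.\<close>

lemma rational_span:
  assumes "x \<in> K" "y \<in> K" "x \<notin> \<rat>" and y: "\<And>a b. \<lbrakk>a \<in> \<rat>; b \<in> \<rat>\<rbrakk> \<Longrightarrow> y \<noteq> a + b * x" and "z \<in> K"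
  shows "\<exists>a\<in>\<rat>. \<exists>b\<in>\<rat>. \<exists>c\<in>\<rat>. z = a + b * x + c * y"
proof -
  obtain x0 x1 x2 where x: "x0 \<in> \<rat>" "x1 \<in> \<rat>" "x2 \<in> \<rat>" "x = x0 + x1 * t + x2 * t\<^sup>2"
    using assms(1) mem_K_iff by blast
  obtain y0 y1 y2 where yy: "y0 \<in> \<rat>" "y1 \<in> \<rat>" "y2 \<in> \<rat>" "y = y0 + y1 * t + y2 * t\<^sup>2"
    using assms(2) mem_K_iff by blast
  obtain z0 z1 z2 where z: "z0 \<in> \<rat>" "z1 \<in> \<rat>" "z2 \<in> \<rat>" "z = z0 + z1 * t + z2 * t\<^sup>2"
    using assms(5) mem_K_iff by blast
  define D where "D = x1 * y2 - x2 * y1"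
  have DQ: "D \<in> \<rat>" unfolding D_def by (intro Rats_diff Rats_mult x yy)
  have "D \<noteq> 0"
  proof
    assume "D = 0"
    hence D: "x1 * y2 = x2 * y1" by (simp add: D_def)
    have "x1 \<noteq> 0 \<or> x2 \<noteq> 0" using x assms(3) by auto
    thus False
    proof
      assume "x1 \<noteq> 0"
      have "y2 = y1 / x1 * x2" using D \<open>x1 \<noteq> 0\<close> by (simp add: field_simps)
      hence eq: "y = (y0 - y1 / x1 * x0) + y1 / x1 * x"
        unfolding yy(4) x(4) using \<open>x1 \<noteq> 0\<close> by (simp add: field_simps)
      have "y0 - y1 / x1 * x0 \<in> \<rat>" "y1 / x1 \<in> \<rat>"
        by (intro Rats_diff Rats_mult Rats_divide x yy)+
      thus False using y eq by blast
    next
      assume "x2 \<noteq> 0"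
      have "y1 = y2 / x2 * x1" using D \<open>x2 \<noteq> 0\<close> by (simp add: field_simps)
      hence eq: "y = (y0 - y2 / x2 * x0) + y2 / x2 * x"
        unfolding yy(4) x(4) using \<open>x2 \<noteq> 0\<close> by (simp add: field_simps)
      have "y0 - y2 / x2 * x0 \<in> \<rat>" "y2 / x2 \<in> \<rat>"
        by (intro Rats_diff Rats_mult Rats_divide x yy)+
      thus False using y eq by blast
    qed
  qed
  define b where "b = (z1 * y2 - z2 * y1) / D"
  define c where "c = (x1 * z2 - x2 * z1) / D"
  have "b * x1 + c * y1 = z1" "b * x2 + c * y2 = z2"
    using \<open>D \<noteq> 0\<close> unfolding b_def c_def by (simp_all add: field_simps) (simp_all add: D_def algebra_simps)
  hence eq: "z1 = b * x1 + c * y1" "z2 = b * x2 + c * y2" by simp_all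
  have "z = (z0 - b * x0 - c * y0) + b * x + c * y"
    unfolding z(4) x(4) yy(4) eq by (simp add: algebra_simps)
  moreover have "b \<in> \<rat>" "c \<in> \<rat>"
    unfolding b_def c_def by (intro Rats_divide Rats_diff Rats_mult x yy z DQ)+
  moreover from this have "z0 - b * x0 - c * y0 \<in> \<rat>"
    by (intro Rats_diff Rats_mult x yy z)
  ultimately show ?thesis by blast
qed

lemma t_notin_Rats: "t \<notin> \<rat>"
  using coords_zero[of "-t" 1 0] by auto

text \<open>The plane Q + Q x cannot contain both t and t^2, as 1, t, t^2 are independent.\<close>

lemma exists_rationally_independent:
  assumes "x \<in> K" "x \<notin> \<rat>"
  shows "\<exists>y\<in>OK. \<forall>a\<in>\<rat>. \<forall>b\<in>\<rat>. y \<noteq> a + b * x"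
proof (rule ccontr)
  assume contra: "\<not> ?thesis"
  obtain x0 x1 x2 where x: "x0 \<in> \<rat>" "x1 \<in> \<rat>" "x2 \<in> \<rat>" "x = x0 + x1 * t + x2 * t\<^sup>2"
    using assms(1) mem_K_iff by blast
  obtain a b where ab: "a \<in> \<rat>" "b \<in> \<rat>" "t = a + b * x"
    using contra t_O by blast
  have "t\<^sup>2 \<in> OK" by (simp add: power2_eq_square mult_O t_O)
  then obtain c d where cd: "c \<in> \<rat>" "d \<in> \<rat>" "t\<^sup>2 = c + d * x"
    using contra by blast
  have "0 + 1 * t + 0 * t\<^sup>2 = (a + b * x0) + (b * x1) * t + (b * x2) * t\<^sup>2"
    using ab(3) unfolding x(4) by (simp add: algebra_simps)
  hence 1: "b * x1 = 1" "b * x2 = 0"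
    using coords_unique[of 0 1 0 "a + b * x0" "b * x1" "b * x2"] ab(1,2) x(1-3) by simp_all
  have "0 + 0 * t + 1 * t\<^sup>2 = (c + d * x0) + (d * x1) * t + (d * x2) * t\<^sup>2"
    using cd(3) unfolding x(4) by (simp add: algebra_simps)
  hence "d * x2 = 1"
    using coords_unique[of 0 0 1 "c + d * x0" "d * x1" "d * x2"] cd(1,2) x(1-3) by simp
  thus False using 1 by auto
qed

text \<open>On the ring of integers q takes nonnegative integer values, so a minimum is
  attained.\<close>

lemma exists_q_minimal:
  assumes "x0 \<in> S" "S \<subseteq> OK"
  obtains x where "x \<in> S" "\<And>y. y \<in> S \<Longrightarrow> q x \<le> q y"
proof -
  obtain x where x: "x \<in> S" "\<And>y. y \<in> S \<Longrightarrow> nat \<lfloor>q x\<rfloor> \<le> nat \<lfloor>q y\<rfloor>"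
    using ex_has_least_nat[of "\<lambda>x. x \<in> S" x0 "\<lambda>x. nat \<lfloor>q x\<rfloor>"] assms(1) by blast
  have "q x \<le> q y" if "y \<in> S" for y
  proof -
    have "q x = of_int \<lfloor>q x\<rfloor>" "q y = of_int \<lfloor>q y\<rfloor>"
      using q_Ints x(1) that assms(2) by (auto elim!: Ints_cases)
    moreover have "\<lfloor>q x\<rfloor> \<le> \<lfloor>q y\<rfloor>"
      using x(2)[OF that] q_nonneg[of x] q_nonneg[of y] by (simp add: nat_le_eq_zle)
    ultimately show ?thesis by linarith
  qed
  thus thesis using that x(1) by blast
qed

text \<open>Successive minima \<open>x\<close>, \<open>y\<close> of \<open>q\<close> on \<open>OK\<close> modulo \<open>\<int>\<close>: rounding the rational coordinates
  of \<open>z\<close> leaves a remainder with \<open>q\<close>-value at most \<open>3/4 q y\<close>, which minimality rules out.\<close>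

lemma exists_reduced_basis:
  obtains x y where "x \<in> OK" "y \<in> OK" "x \<notin> \<int>" "\<And>z. \<lbrakk>z \<in> OK; z \<notin> \<int>\<rbrakk> \<Longrightarrow> q x \<le> q z"
    "\<bar>qpolar x y\<bar> \<le> q x"
    "\<And>z. z \<in> OK \<Longrightarrow> \<exists>a b c :: int. z = of_int a + of_int b * x + of_int c * y"
proof -
  have "t \<notin> \<int>" using t_notin_Rats Ints_subset_Rats by blast
  hence "t \<in> OK - \<int>" using t_O by simp
  then obtain x where x: "x \<in> OK - \<int>" and xmin: "\<And>z. z \<in> OK - \<int> \<Longrightarrow> q x \<le> q z"
    using exists_q_minimal[of t "OK - \<int>"] by blast
  have xO: "x \<in> OK" "x \<in> K" and xQ: "x \<notin> \<rat>" 
    using x Rats_O O_K by auto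
  define S where "S = {y \<in> OK. \<forall>a\<in>\<rat>. \<forall>b\<in>\<rat>. y \<noteq> a + b * x}"
  obtain y0 where "y0 \<in> S" using exists_rationally_independent[OF xO(2) xQ] by (auto simp: S_def)
  then obtain y where y: "y \<in> S" and ymin: "\<And>z. z \<in> S \<Longrightarrow> q y \<le> q z"
    using exists_q_minimal[of y0 S] by (auto simp: S_def)
  have yO: "y \<in> OK" "y \<in> K" and yS: "\<And>a b. \<lbrakk>a \<in> \<rat>; b \<in> \<rat>\<rbrakk> \<Longrightarrow> y \<noteq> a + b * x"
    using y O_K by (auto simp: S_def)
  have "q x > 0"
    using q_eq_0_imp_Rats[OF xO(2)] xQ q_nonneg[of x] by force
  have qxy: "q x \<le> q y"
    using xmin[of y] yO yS[of y 0] Ints_subset_Rats by auto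
  \<comment> \<open>Minimality of y against y + x and y - x bounds the polar form on both
    sides.\<close>
  have "q y \<le> q (0 + c * x + 1 * y)" if "c \<in> \<int>" for c
  proof (rule ymin)
    have "c * x + y \<noteq> a + b * x" if "a \<in> \<rat>" "b \<in> \<rat>" for a b
    proof
      assume "c * x + y = a + b * x"
      hence "y = a + (b - c) * x" by (simp add: algebra_simps)
      thus False using yS[of a "b - c"] that \<open>c \<in> \<int>\<close> Ints_subset_Rats by auto
    qed
    thus "0 + c * x + 1 * y \<in> S" using that by (auto simp: S_def xO yO add_O mult_O Ints_O)
  qed
  from this[of 1] this[of "-1"] have polar: "\<bar>qpolar x y\<bar> \<le> q x"
    using q_comb[OF xO(2) yO(2), of 0 1 1] q_comb[OF xO(2) yO(2), of 0 "-1" 1] by simp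
  have "\<exists>a b c :: int. z = of_int a + of_int b * x + of_int c * y" if z: "z \<in> OK" for z
  proof -
    obtain a b c where abc: "a \<in> \<rat>" "b \<in> \<rat>" "c \<in> \<rat>" "z = a + b * x + c * y"
      using rational_span[OF xO(2) yO(2) xQ yS O_K[OF z]] by blast
    define z' where "z' = z - of_int (round b) * x - of_int (round c) * y"
    define b' c' where "b' = b - of_int (round b)" and "c' = c - of_int (round c)"
    have b'c': "\<bar>b'\<bar> \<le> 1/2" "\<bar>c'\<bar> \<le> 1/2" "b' \<in> \<rat>" "c' \<in> \<rat>"
      unfolding b'_def c'_def using of_int_round_abs_le[of b] of_int_round_abs_le[of c] abc
      by (auto simp: abs_minus_commute)
    have z'OK: "z' \<in> OK" unfolding z'_def by (intro diff_O mult_O that xO yO Ints_O) auto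
    have "z' = a + b' * x + c' * y" by (simp add: z'_def b'_def c'_def abc algebra_simps)
    hence "q z' = b'\<^sup>2 * q x + b' * c' * qpolar x y + c'\<^sup>2 * q y"
      using q_comb[OF xO(2) yO(2) abc(1) b'c'(3,4)] by simp
    also have "\<dots> \<le> 1/4 * q y + 1/4 * q y + 1/4 * q y"
    proof (intro add_mono)
      have "b'\<^sup>2 \<le> 1/4" "c'\<^sup>2 \<le> 1/4"
        using power_mono[OF b'c'(1), of 2] power_mono[OF b'c'(2), of 2] by (simp_all add: power2_eq_square)
      thus "b'\<^sup>2 * q x \<le> 1/4 * q y" "c'\<^sup>2 * q y \<le> 1/4 * q y"
        using qxy q_nonneg[of x] by (intro mult_mono; simp)+
      have "\<bar>b' * c' * qpolar x y\<bar> \<le> 1/2 * (1/2) * q y"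
        unfolding abs_mult using b'c' polar qxy by (intro mult_mono) auto
      thus "b' * c' * qpolar x y \<le> 1/4 * q y" by linarith
    qed
    also have "\<dots> < q y" using \<open>q x > 0\<close> qxy by simp
    finally have "z' \<notin> S" using ymin[of z'] by linarith
    then obtain u v where uv: "u \<in> \<rat>" "v \<in> \<rat>" "z' = u + v * x"
      using z'OK by (auto simp: S_def)
    \<comment> \<open>The remainder lies in Q + Q x. A second rounding, now along x alone, brings q
      below its minimum \<open>q x\<close> on non-integers, so what is left is an integer.\<close>
    define z'' where "z'' = z' - of_int (round v) * x"
    define v' where "v' = v - of_int (round v)"
    have v': "\<bar>v'\<bar> \<le> 1/2" "v' \<in> \<rat>"
      unfolding v'_def using of_int_round_abs_le[of v] uv by (auto simp: abs_minus_commute)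
    have z''OK: "z'' \<in> OK" unfolding z''_def by (intro diff_O mult_O z'OK xO Ints_O) auto
    have "z'' = u + v' * x + 0 * x" by (simp add: z''_def v'_def uv algebra_simps)
    hence "q z'' = v'\<^sup>2 * q x"
      using q_comb[OF xO(2) xO(2) uv(1) v'(2), of 0] by simp
    also have "\<dots> \<le> 1/4 * q x"
    proof (intro mult_right_mono q_nonneg)
      show "v'\<^sup>2 \<le> 1/4" using power_mono[OF v'(1), of 2] by (simp add: power2_eq_square)
    qed
    also have "\<dots> < q x" using \<open>q x > 0\<close> by simp
    finally have "z'' \<in> \<int>" using xmin[of z''] z''OK by force
    then obtain n where "z'' = of_int n" by (elim Ints_cases)
    hence "z = of_int n + of_int (round b + round v) * x + of_int (round c) * y"
      by (simp add: z''_def z'_def algebra_simps)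
    thus ?thesis by blast
  qed
  thus thesis using that[of x y] xO yO x xmin polar by auto
qed

end

section \<open>Rational polynomials at real numbers and the construction of the conjugations\<close>

abbreviation rpoly :: "rat poly \<Rightarrow> real \<Rightarrow> real" where "rpoly g x \<equiv> poly (map_poly of_rat g) x"

lemma rpoly_simps:
  "rpoly (g + h) x = rpoly g x + rpoly h x" "rpoly (g * h) x = rpoly g x * rpoly h x"
  "rpoly (g - h) x = rpoly g x - rpoly h x" "rpoly 0 x = 0" "rpoly 1 x = 1"
  "rpoly (pCons a g) x = of_rat a + x * rpoly g x"
proof -
  interpret map_poly_comm_ring_hom "of_rat :: rat \<Rightarrow> real" ..
  show "rpoly (g + h) x = rpoly g x + rpoly h x" "rpoly (g * h) x = rpoly g x * rpoly h x"
    "rpoly (g - h) x = rpoly g x - rpoly h x" "rpoly 0 x = 0" "rpoly 1 x = 1"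
    "rpoly (pCons a g) x = of_rat a + x * rpoly g x"
    by (simp_all add: hom_distribs)
qed

lemma rpoly_quadratic_scaled:
  "rpoly [:a, b * of_int n, c * (of_int n)\<^sup>2:] x =
     of_rat a + of_rat b * (of_int n * x) + of_rat c * (of_int n * x)\<^sup>2"
  unfolding rpoly_simps of_rat_mult of_rat_power of_rat_of_int_eq
  by (simp only: power2_eq_square distrib_left mult_ac)

lemma poly_degree_3_cases:
  fixes p :: "'a :: zero poly"
  assumes "degree p \<le> 3"
  obtains a b c d where "p = [:a, b, c, d:]"
proof -
  obtain a b c d e where p: "p = pCons a (pCons b (pCons c (pCons d e)))"
    by (metis pCons_cases)
  have "e = 0"
  proof (rule ccontr)
    assume "e \<noteq> 0"
    thus False using assms by (simp add: p)
  qed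
  thus thesis using that p by blast
qed

text \<open>A polynomial m of least degree vanishing at x divides every polynomial vanishing there;
  it divides the irreducible p, hence is p up to a unit.\<close>

lemma irreducible_dvd_if_common_root:
  assumes p: "Factorial_Ring.irreducible p" "rpoly p x = 0" and g: "rpoly g x = 0"
  shows "p dvd g"
proof -
  have "p \<noteq> 0" using p(1) by auto
  obtain m where m: "m \<noteq> 0" "rpoly m x = 0"
    and min: "\<And>h. \<lbrakk>h \<noteq> 0; rpoly h x = 0\<rbrakk> \<Longrightarrow> degree m \<le> degree h"
    using ex_has_least_nat[of "\<lambda>h. h \<noteq> 0 \<and> rpoly h x = 0" p degree] \<open>p \<noteq> 0\<close> p(2) by blast
  have m_dvd: "m dvd h" if "rpoly h x = 0" for h
  proof (rule ccontr)
    assume "\<not> m dvd h"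
    hence "h mod m \<noteq> 0" by (simp add: dvd_eq_mod_eq_0)
    moreover have "rpoly h x = rpoly (m * (h div m) + h mod m) x" by simp
    hence "rpoly (h mod m) x = 0" unfolding rpoly_simps using m(2) that by simp
    moreover have "degree (h mod m) < degree m"
      using degree_mod_less[OF m(1), of h] \<open>h mod m \<noteq> 0\<close> by blast
    ultimately show False using min[of "h mod m"] by simp
  qed
  obtain k where k: "p = m * k" using m_dvd[OF p(2)] by (elim dvdE)
  have "\<not> m dvd 1"
  proof
    assume "m dvd 1"
    then obtain u where "1 = m * u" by (elim dvdE)
    hence "rpoly 1 x = rpoly m x * rpoly u x" by (metis rpoly_simps(2))
    thus False using m(2) by (simp add: rpoly_simps)
  qed
  hence "k dvd 1" using p(1) k by (auto dest: irreducibleD)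
  hence "p dvd m" unfolding k using mult_dvd_mono[of m m k 1] by simp
  thus ?thesis using m_dvd[OF g] by (rule dvd_trans)
qed

lemma real_embedding_Rats:
  assumes "real_embedding K \<sigma>" and K: "\<rat> \<subseteq> K" and "x \<in> \<rat>"
  shows "\<sigma> x = x"
proof -
  have add: "\<sigma> (x + y) = \<sigma> x + \<sigma> y" and mult: "\<sigma> (x * y) = \<sigma> x * \<sigma> y" if "x \<in> \<rat>" "y \<in> \<rat>" for x y
    using assms that unfolding real_embedding_def by blast+
  have one: "\<sigma> 1 = 1" using assms unfolding real_embedding_def by blast
  have zero: "\<sigma> 0 = 0" using add[of 0 0] by simp
  have nat: "\<sigma> (of_nat n) = of_nat n" for n
    by (induction n) (simp_all add: zero one add)
  have int: "\<sigma> (of_int n) = of_int n" for n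
  proof (cases "n \<ge> 0")
    case True
    thus ?thesis using nat[of "nat n"] by simp
  next
    case False
    thus ?thesis using nat[of "nat (- n)"] add[of "of_int n" "of_int (- n)"] zero by simp
  qed
  obtain a b :: int where ab: "b \<noteq> 0" "x = of_int a / of_int b"
    using \<open>x \<in> \<rat>\<close> by (metis Rats_cases' less_numeral_extra(3))
  have "\<sigma> x * of_int b = \<sigma> (x * of_int b)" using mult[of x "of_int b"] int \<open>x \<in> \<rat>\<close> by simp
  also have "\<dots> = of_int a" using ab int by simp
  finally have "\<sigma> x = of_int a / of_int b" using ab(1) by (simp add: eq_divide_eq)
  thus ?thesis using ab(2)[symmetric] by (rule trans)
qed

lemma real_embedding_rpoly:
  assumes "real_embedding (rat_adjoin \<theta>) \<sigma>"
  shows "\<sigma> (rpoly g \<theta>) = rpoly g (\<sigma> \<theta>)"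
proof -
  have mem: "rpoly g \<theta> \<in> rat_adjoin \<theta>" for g by (auto simp: rat_adjoin_def)
  have Rats: "\<rat> \<subseteq> rat_adjoin \<theta>"
  proof
    fix x :: real assume "x \<in> \<rat>"
    then obtain a where "x = of_rat a" by (elim Rats_cases)
    thus "x \<in> rat_adjoin \<theta>" using mem[of "[:a:]"] by (simp add: rpoly_simps)
  qed
  have \<theta>: "\<theta> \<in> rat_adjoin \<theta>" using mem[of "[:0, 1:]"] by (simp add: rpoly_simps)
  show ?thesis
  proof (induction g)
    case 0
    show ?case using real_embedding_Rats[OF assms Rats, of 0] by (simp add: rpoly_simps)
  next
    case (pCons a g)
    have "\<sigma> (of_rat a + \<theta> * rpoly g \<theta>) = \<sigma> (of_rat a) + \<sigma> (\<theta> * rpoly g \<theta>)"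
      using assms mem[of "pCons 0 g"] Rats unfolding real_embedding_def
      by (simp add: rpoly_simps subset_iff)
    also have "\<dots> = of_rat a + \<sigma> \<theta> * \<sigma> (rpoly g \<theta>)"
      using assms mem[of g] \<theta> real_embedding_Rats[OF assms Rats, of "of_rat a"]
      unfolding real_embedding_def by simp
    finally show ?case using pCons by (simp add: rpoly_simps)
  qed
qed

text \<open>Vieta's formulas from divided differences: subtracting the equations of two distinct
  roots and dividing by their difference lowers the degree, and doing so twice gives the sum of the
  roots.\<close>

lemma cubic_root_sums:
  fixes a b c d r0 r1 r2 :: real
  assumes "r0 \<noteq> r1" "r0 \<noteq> r2" "r1 \<noteq> r2" "d \<noteq> 0"
    and "\<And>r. r \<in> {r0, r1, r2} \<Longrightarrow> a + b * r + c * r\<^sup>2 + d * r ^ 3 = 0"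
  shows "r0 + r1 + r2 = - c / d" "r0\<^sup>2 + r1\<^sup>2 + r2\<^sup>2 = (c / d)\<^sup>2 - 2 * b / d"
proof -
  have eq: "a + b * r0 + c * r0\<^sup>2 + d * r0 ^ 3 = 0" "a + b * r1 + c * r1\<^sup>2 + d * r1 ^ 3 = 0"
    "a + b * r2 + c * r2\<^sup>2 + d * r2 ^ 3 = 0" using assms(5) by auto
  have dd: "b + c * (u + v) + d * (u\<^sup>2 + u * v + v\<^sup>2) = 0"
    if "u \<noteq> v" "a + b * u + c * u\<^sup>2 + d * u ^ 3 = 0" "a + b * v + c * v\<^sup>2 + d * v ^ 3 = 0" for u v
  proof -
    have "(u - v) * (b + c * (u + v) + d * (u\<^sup>2 + u * v + v\<^sup>2)) =
      (a + b * u + c * u\<^sup>2 + d * u ^ 3) - (a + b * v + c * v\<^sup>2 + d * v ^ 3)"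
      by (simp add: power2_eq_square power3_eq_cube algebra_simps)
    thus ?thesis using that by simp
  qed
  have 1: "b + c * (r0 + r1) + d * (r0\<^sup>2 + r0 * r1 + r1\<^sup>2) = 0" 
    and 2: "b + c * (r0 + r2) + d * (r0\<^sup>2 + r0 * r2 + r2\<^sup>2) = 0"
    using dd eq assms(1,2) by blast+
  have "(r1 - r2) * (c + d * (r0 + r1 + r2)) =
     (b + c * (r0 + r1) + d * (r0\<^sup>2 + r0 * r1 + r1\<^sup>2)) - (b + c * (r0 + r2) + d * (r0\<^sup>2 + r0 * r2 + r2\<^sup>2))"
    by (simp add: power2_eq_square algebra_simps)
  hence sum: "c = - d * (r0 + r1 + r2)" using 1 2 assms(3) by simp
  thus "r0 + r1 + r2 = - c / d" using assms(4) by simp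
  have "b = d * (r0 * r1 + r0 * r2 + r1 * r2)"
    using 1 unfolding sum by (simp add: power2_eq_square algebra_simps)
  hence "2 * b / d = 2 * (r0 * r1 + r0 * r2 + r1 * r2)" using assms(4) by simp
  moreover have cd: "c / d = - (r0 + r1 + r2)" using sum assms(4) by simp
  ultimately show "r0\<^sup>2 + r1\<^sup>2 + r2\<^sup>2 = (c / d)\<^sup>2 - 2 * b / d"
    unfolding cd by (simp add: power2_eq_square algebra_simps)
qed

lemma algebraic_int_multiple_of_root:
  fixes \<theta> :: real
  assumes "degree p = 3" "rpoly p \<theta> = 0"
  obtains n :: int where "n \<noteq> 0" "algebraic_int (of_int n * \<theta>)"
proof -
  obtain a b c d where p: "p = [:a, b, c, d:]"
    by (rule poly_degree_3_cases[of p]) (use assms(1) in auto)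
  have "d \<noteq> 0" using assms(1) unfolding p by (auto split: if_splits)
  have root: "of_rat a + of_rat b * \<theta> + of_rat c * \<theta>\<^sup>2 + of_rat d * \<theta> ^ 3 = 0"
    using assms(2) by (simp add: p rpoly_simps power2_eq_square power3_eq_cube algebra_simps)
  have "\<exists>n::int. n \<noteq> 0 \<and> (\<forall>x\<in>set xs. of_int n * x \<in> \<int>)" if "set xs \<subseteq> \<rat>" for xs :: "real list"
    using that
  proof (induction xs)
    case (Cons x xs)
    then obtain n :: int where n: "n \<noteq> 0" "\<forall>x\<in>set xs. of_int n * x \<in> \<int>" by auto
    obtain a b :: int where ab: "b \<noteq> 0" "x = of_int a / of_int b"
      using Cons.prems by (metis Rats_cases' less_numeral_extra(3) list.set_intros(1) subsetD)
    have "real_of_int (n * b) * y \<in> \<int>" if "y \<in> set (x # xs)" for y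
    proof (cases "y = x")
      case True
      hence "real_of_int (n * b) * y = of_int (n * a)" using ab by simp
      thus ?thesis by (metis Ints_of_int)
    next
      case False
      hence "of_int n * y \<in> \<int>" using n that by simp
      hence "of_int b * (of_int n * y) \<in> \<int>" by (rule Ints_mult[OF Ints_of_int])
      thus ?thesis by (simp add: mult_ac)
    qed
    thus ?case using n ab by (intro exI[of _ "n * b"]) auto
  qed (auto intro: exI[of _ 1])
  note common_denominator = this
  define A B C where "A = (of_rat (a / d) :: real)" and "B = (of_rat (b / d) :: real)"
    and "C = (of_rat (c / d) :: real)"
  have "(of_rat a + of_rat b * \<theta> + of_rat c * \<theta>\<^sup>2 + of_rat d * \<theta> ^ 3) / of_rat d = 0"
    using root by simp
  hence root': "A + B * \<theta> + C * \<theta>\<^sup>2 + \<theta> ^ 3 = 0"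
    using \<open>d \<noteq> 0\<close> by (simp add: A_def B_def C_def of_rat_divide add_divide_distrib)
  have "set [A, B, C] \<subseteq> \<rat>" by (simp add: A_def B_def C_def)
  from common_denominator[OF this] obtain n :: int
    where n: "n \<noteq> 0" and ints: "of_int n * A \<in> \<int>" "of_int n * B \<in> \<int>" "of_int n * C \<in> \<int>"
    by auto
  \<comment> \<open>The monic cubic with its roots multiplied by n: the coefficient of X^i gains
    n^(3 - i), and one of these factors clears its denominator.\<close>
  let ?p = "[:of_int n * of_int n * (of_int n * A), of_int n * (of_int n * B), of_int n * C, 1:]"
  have "algebraic_int (of_int n * \<theta>)"
  proof (rule algebraic_int.intros[of ?p])
    show "\<forall>i. coeff ?p i \<in> \<int>"
      using ints Ints_mult[OF Ints_mult[OF Ints_of_int Ints_of_int] ints(1)] Ints_mult[OF Ints_of_int ints(2)]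
      by (auto simp: coeff_pCons split: nat.splits)
    have "poly ?p (of_int n * \<theta>) = of_int n ^ 3 * (A + B * \<theta> + C * \<theta>\<^sup>2 + \<theta> ^ 3)"
      unfolding poly_pCons poly_0 power2_eq_square power3_eq_cube
      by (simp only: distrib_left distrib_right mult_ac add.assoc mult_1_right mult_zero_right add_0_right)
    thus "poly ?p (of_int n * \<theta>) = 0" using root' by simp
  qed auto
  thus thesis using that n by blast
qed

text \<open>The conjugations send g(\<theta>) to g(r) for the three real roots r of p. The generator
  t is an integral multiple of \<theta> by a nonzero integer, which makes it an algebraic
  integer.\<close>

lemma totally_real_cubic_field_cubic_field:
  assumes "totally_real_cubic_field K"
  obtains t s where "cubic_field K t s"
proof -
  obtain \<theta> and p :: "rat poly" where p: "Factorial_Ring.irreducible p" "degree p = 3" and \<theta>: "rpoly p \<theta> = 0"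
      and card: "card {x :: real. rpoly p x = 0} = 3" and K: "K = rat_adjoin \<theta>"
    using assms unfolding totally_real_cubic_field_def by blast
  obtain r0 r1 r2 where R: "{x :: real. rpoly p x = 0} = {r0, r1, r2}" "r0 \<noteq> r1" "r0 \<noteq> r2" "r1 \<noteq> r2"
    using card by (auto simp: card_3_iff)
  \<comment> \<open>All indices from 2 on give \<open>r2\<close>, so that the locale conditions hold
    for every i.\<close>
  define r where "r i = (if i = 0 then r0 else if i = (1::nat) then r1 else r2)" for i
  have root: "rpoly p (r i) = 0" for i using R(1) by (auto simp: r_def)
  \<comment> \<open>All roots share the irreducible p, so vanishing does not depend on the root.
    This makes \<open>s\<close> independent of the chosen g, and injective.\<close>
  have vanish: "rpoly g (r i) = 0 \<longleftrightarrow> rpoly g \<theta> = 0" for g i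
    using irreducible_dvd_if_common_root[OF p(1) root[of i], of g]
      irreducible_dvd_if_common_root[OF p(1) \<theta>, of g] root[of i] \<theta> 
    by (auto elim!: dvdE simp: rpoly_simps)
  define s where "s i x = rpoly (SOME g. rpoly g \<theta> = x) (r i)" for i x
  have s: "s i (rpoly g \<theta>) = rpoly g (r i)" for i g
  proof -
    define h where "h = (SOME h. rpoly h \<theta> = rpoly g \<theta>)"
    have "rpoly h \<theta> = rpoly g \<theta>" unfolding h_def by (rule someI[of _ g]) simp
    hence "rpoly (h - g) (r i) = 0" unfolding vanish by (simp add: rpoly_simps)
    thus ?thesis unfolding s_def h_def[symmetric] by (simp add: rpoly_simps)
  qed
  have memK: "x \<in> K \<longleftrightarrow> (\<exists>g. x = rpoly g \<theta>)" for x unfolding K rat_adjoin_def by auto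
  obtain n :: int where n: "n \<noteq> 0" "algebraic_int (of_int n * \<theta>)"
    using algebraic_int_multiple_of_root[OF p(2) \<theta>] by blast
  define t where "t = of_int n * \<theta>"
  let ?n = "of_int n :: rat"
  have quad: "a + b * t + c * t\<^sup>2 = rpoly [:a', b' * ?n, c' * ?n\<^sup>2:] \<theta>"
    if "a = of_rat a'" "b = of_rat b'" "c = of_rat c'" for a b c a' b' c'
    unfolding t_def that by (rule rpoly_quadratic_scaled[symmetric])
  have small: "\<exists>a b c. rpoly g \<theta> = rpoly [:a, b, c:] \<theta>" for g
  proof -
    have "rpoly g \<theta> = rpoly (p * (g div p) + g mod p) \<theta>" by simp
    also have "\<dots> = rpoly (g mod p) \<theta>" unfolding rpoly_simps by (simp add: \<theta>)
    finally have "rpoly g \<theta> = rpoly (g mod p) \<theta>" .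
    moreover have "degree (g mod p) < 3"
      using degree_mod_less[of p g] p(2) by fastforce
    moreover obtain a b c d where mod: "g mod p = [:a, b, c, d:]"
      by (rule poly_degree_3_cases[of "g mod p"]) (use \<open>degree (g mod p) < 3\<close> in auto)
    have "d = 0" using \<open>degree (g mod p) < 3\<close> unfolding mod by (auto split: if_splits)
    ultimately show ?thesis unfolding mod by auto
  qed
  have "cubic_field K t s"
  proof
    fix x
    show "x \<in> K \<longleftrightarrow> (\<exists>a\<in>\<rat>. \<exists>b\<in>\<rat>. \<exists>c\<in>\<rat>. x = a + b * t + c * t\<^sup>2)"
    proof
      assume "x \<in> K"
      then obtain g where "x = rpoly g \<theta>" using memK[of x] by blast
      then obtain a b c where "x = rpoly [:a, b, c:] \<theta>" using small[of g] by metis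
      also have "\<dots> = rpoly [:a, b / ?n * ?n, c / ?n\<^sup>2 * ?n\<^sup>2:] \<theta>" using n by simp
      also have "\<dots> = of_rat a + of_rat (b / ?n) * t + of_rat (c / ?n\<^sup>2) * t\<^sup>2"
        by (rule quad[symmetric]) simp_all
      finally show "\<exists>a\<in>\<rat>. \<exists>b\<in>\<rat>. \<exists>c\<in>\<rat>. x = a + b * t + c * t\<^sup>2" using Rats_of_rat by blast
    next
      assume "\<exists>a\<in>\<rat>. \<exists>b\<in>\<rat>. \<exists>c\<in>\<rat>. x = a + b * t + c * t\<^sup>2"
      thus "x \<in> K" unfolding memK using quad by (metis Rats_cases)
    qed
  next
    fix a b c :: real
    assume abc: "a \<in> \<rat>" "b \<in> \<rat>" "c \<in> \<rat>" "a + b * t + c * t\<^sup>2 = 0"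
    then obtain a' b' c' where eq: "a = of_rat a'" "b = of_rat b'" "c = of_rat c'" by (auto elim!: Rats_cases)
    hence "p dvd [:a', b' * ?n, c' * ?n\<^sup>2:]"
      using irreducible_dvd_if_common_root[OF p(1) \<theta>] quad abc(4) by metis
    moreover have "degree [:a', b' * ?n, c' * ?n\<^sup>2:] \<le> 2" by (simp add: degree_pCons_eq_if)
    ultimately have "[:a', b' * ?n, c' * ?n\<^sup>2:] = 0"
      using dvd_imp_degree_le[of p "[:a', b' * ?n, c' * ?n\<^sup>2:]"] p(2) by linarith
    thus "a = 0 \<and> b = 0 \<and> c = 0" using n eq by simp
  next
    fix x y assume "x \<in> K" "y \<in> K"
    then obtain g h where gh: "x = rpoly g \<theta>" "y = rpoly h \<theta>" using memK by blast
    show "x * y \<in> K" unfolding memK gh by (metis rpoly_simps(2))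
    fix i
    show "s i (x + y) = s i x + s i y" unfolding gh by (simp add: s flip: rpoly_simps)
    show "s i (x * y) = s i x * s i y" unfolding gh by (simp add: s flip: rpoly_simps)
  next
    fix x :: real and i assume "x \<in> \<rat>"
    then obtain a where "x = of_rat a" by (elim Rats_cases)
    thus "s i x = x" using s[of i "[:a:]"] by (simp add: rpoly_simps)
  next
    fix x i assume "x \<in> K" "s i x = 0"
    thus "x = 0" using memK s vanish by metis
  next
    fix \<sigma> assume \<sigma>: "real_embedding K \<sigma>"
    have emb: "\<sigma> (rpoly g \<theta>) = rpoly g (\<sigma> \<theta>)" for g
      using real_embedding_rpoly \<sigma> unfolding K by blast
    have "\<sigma> 0 = 0" using emb[of 0] by (simp add: rpoly_simps)
    hence "rpoly p (\<sigma> \<theta>) = 0" using emb[of p] \<theta> by simp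
    hence "\<sigma> \<theta> \<in> {r0, r1, r2}" using R(1) by blast
    hence "\<exists>i<3. \<sigma> \<theta> = r i" unfolding r_def by (auto intro: exI[of _ 0] exI[of _ 1] exI[of _ 2])
    thus "\<exists>i<3. \<forall>x\<in>K. \<sigma> x = s i x" using memK s emb by metis
  next
    fix x assume "x \<in> K"
    then obtain g where "x = rpoly g \<theta>" using memK[of x] by blast
    then obtain a b c where x: "x = rpoly [:a, b, c:] \<theta>" using small[of g] by metis
    obtain p0 p1 p2 p3 where pp: "p = [:p0, p1, p2, p3:]"
      by (rule poly_degree_3_cases[of p]) (use p(2) in auto)
    have "p3 \<noteq> 0" using p(2) unfolding pp by (auto split: if_splits)
    have "of_rat p0 + of_rat p1 * z + of_rat p2 * z\<^sup>2 + of_rat p3 * z ^ 3 = 0" if "z \<in> {r0, r1, r2}" for z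
      using that R(1) by (auto simp: pp rpoly_simps power2_eq_square power3_eq_cube algebra_simps)
    note sums = cubic_root_sums[OF R(2-4) _ this]
    have "s 0 x + s 1 x + s 2 x = 3 * of_rat a + of_rat b * (r0 + r1 + r2) + of_rat c * (r0\<^sup>2 + r1\<^sup>2 + r2\<^sup>2)"
      unfolding x s by (simp add: rpoly_simps r_def power2_eq_square algebra_simps)
    also have "\<dots> = 3 * of_rat a + of_rat b * (- of_rat p2 / of_rat p3) + of_rat c * ((of_rat p2 / of_rat p3)\<^sup>2 - 2 * of_rat p1 / of_rat p3)"
      using sums \<open>p3 \<noteq> 0\<close> by simp
    also have "\<dots> \<in> \<rat>" by simp
    finally show "s 0 x + s 1 x + s 2 x \<in> \<rat>" .
  next
    show "algebraic_int t" using n(2) unfolding t_def .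
  qed
  thus thesis by (rule that)
qed

section \<open>Traces of represented elements\<close>

definition qf_polar :: "nat \<Rightarrow> (nat \<Rightarrow> nat \<Rightarrow> int) \<Rightarrow> (nat \<Rightarrow> real) \<Rightarrow> (nat \<Rightarrow> real) \<Rightarrow> real" where
  "qf_polar r a u v = (\<Sum>i<r. \<Sum>j\<in>{i..<r}. of_int (a i j) * (u i * v j + v i * u j))"

lemma qf_eval_cong:
  assumes "\<And>i. i < r \<Longrightarrow> u i = v i"
  shows "qf_eval r a u = qf_eval r a v"
  unfolding qf_eval_def using assms by (intro sum.cong) auto

lemma qf_eval_comb:
  "qf_eval r a (\<lambda>i. b * u i + c * v i + d * w i) =
     b\<^sup>2 * qf_eval r a u + c\<^sup>2 * qf_eval r a v + d\<^sup>2 * qf_eval r a w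
     + b * c * qf_polar r a u v + b * d * qf_polar r a u w + c * d * qf_polar r a v w"
  unfolding qf_eval_def qf_polar_def sum_distrib_left sum.distrib[symmetric]
  by (intro sum.cong refl) (simp add: power2_eq_square algebra_simps)

lemma qf_eval_comb2:
  "qf_eval r a (\<lambda>i. b * u i + c * v i) =
     b\<^sup>2 * qf_eval r a u + c\<^sup>2 * qf_eval r a v + b * c * qf_polar r a u v"
  using qf_eval_comb[of r a b u c v 0 v] by simp

lemma qf_eval_Ints: "(\<And>i. i < r \<Longrightarrow> u i \<in> \<int>) \<Longrightarrow> qf_eval r a u \<in> \<int>"
  unfolding qf_eval_def by (intro Ints_sum Ints_mult) auto

lemma qf_polar_Ints: "(\<And>i. i < r \<Longrightarrow> u i \<in> \<int>) \<Longrightarrow> (\<And>i. i < r \<Longrightarrow> v i \<in> \<int>) \<Longrightarrow> qf_polar r a u v \<in> \<int>"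
  unfolding qf_polar_def by (intro Ints_sum Ints_mult Ints_add) auto

lemma Z_form_nonneg:
  assumes "Z_form r a"
  shows "qf_eval r a u \<ge> 0"
proof (cases "\<exists>i<r. u i \<noteq> 0")
  case True
  thus ?thesis using assms unfolding Z_form_def by (simp add: less_imp_le)
next
  case False
  hence "qf_eval r a u = qf_eval r a (\<lambda>_. 0)" by (intro qf_eval_cong) auto
  thus ?thesis by (simp add: qf_eval_def)
qed

lemma Z_form_ge_1:
  assumes "Z_form r a" "\<And>i. i < r \<Longrightarrow> u i \<in> \<int>" "\<exists>i<r. u i \<noteq> 0"
  shows "qf_eval r a u \<ge> 1"
proof -
  have "qf_eval r a u > 0" using assms unfolding Z_form_def by blast
  moreover obtain n where "qf_eval r a u = of_int n"
    using qf_eval_Ints[of r u a] assms(2) by (auto elim!: Ints_cases)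
  ultimately show ?thesis by simp
qed

text \<open>Cauchy-Schwarz: evaluate the form at B u - 2 Q(u) v, where B is the polar value, and
  divide by Q(u) > 0.\<close>

lemma Z_form_discriminant:
  assumes "Z_form r a"
  shows "(qf_polar r a u v)\<^sup>2 \<le> 4 * qf_eval r a u * qf_eval r a v"
proof (cases "\<exists>i<r. u i \<noteq> 0")
  case True
  hence pos: "qf_eval r a u > 0" using assms unfolding Z_form_def by blast
  have "0 \<le> qf_eval r a (\<lambda>i. qf_polar r a u v * u i + (- 2 * qf_eval r a u) * v i)"
    by (rule Z_form_nonneg[OF assms])
  also have "\<dots> = qf_eval r a u * (4 * qf_eval r a u * qf_eval r a v - (qf_polar r a u v)\<^sup>2)"
    unfolding qf_eval_comb2 by (simp add: power2_eq_square algebra_simps)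
  finally show ?thesis using pos by (simp add: zero_le_mult_iff)
next
  case False
  hence "qf_eval r a u = 0" "qf_polar r a u v = 0"
    unfolding qf_eval_def qf_polar_def by (auto intro!: sum.neutral)
  thus ?thesis by simp
qed

text \<open>Both u + v and u - v are nonzero integer vectors, so Q is at least 1 on each.\<close>

lemma Z_form_polar_bound:
  assumes "Z_form r a" "\<And>i. i < r \<Longrightarrow> u i \<in> \<int>" "\<And>i. i < r \<Longrightarrow> v i \<in> \<int>"
    and "\<exists>i<r. u i \<noteq> v i" "\<exists>i<r. u i \<noteq> - v i"
  shows "\<bar>qf_polar r a u v\<bar> \<le> qf_eval r a u + qf_eval r a v - 1"
proof -
  have "1 \<le> qf_eval r a (\<lambda>i. 1 * u i + 1 * v i)"
    using assms by (intro Z_form_ge_1) (auto simp: eq_neg_iff_add_eq_0)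
  moreover have "1 \<le> qf_eval r a (\<lambda>i. 1 * u i + (- 1) * v i)"
    using assms by (intro Z_form_ge_1) auto
  ultimately show ?thesis unfolding qf_eval_comb2 by simp
qed

text \<open>Completing the square gives 4 C (C x^2 + B x + A) = (2 C x + B)^2 + D with D = 4 C A -
  B^2; three times the sum of three squares is the square of the sum plus the squared
  differences.\<close>

lemma sum_quadratic_values:
  fixes A B C x y z :: real
  shows "12 * C * ((C * x\<^sup>2 + B * x + A) + (C * y\<^sup>2 + B * y + A) + (C * z\<^sup>2 + B * z + A)) =
    (2 * C * (x + y + z) + 3 * B)\<^sup>2 + 8 * C\<^sup>2 * (((x - y)\<^sup>2 + (y - z)\<^sup>2 + (z - x)\<^sup>2) / 2)
    + 9 * (4 * C * A - B\<^sup>2)"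
proof -
  have *: "8 * C\<^sup>2 * (w / 2) = 4 * C\<^sup>2 * w" for w by simp
  show ?thesis unfolding * by (simp add: power2_eq_square algebra_simps)
qed

context cubic_field
begin

lemma s_sum:
  assumes "\<And>i. i \<in> A \<Longrightarrow> f i \<in> K"
  shows "sum f A \<in> K \<and> s k (sum f A) = (\<Sum>i\<in>A. s k (f i))"
  using assms
  by (induction A rule: infinite_finite_induct) (auto simp: s_Rats Rats_K s_add add_K)

lemma s_qf_eval:
  assumes v: "\<And>i. i < r \<Longrightarrow> v i \<in> K"
  shows "s k (qf_eval r a v) = qf_eval r a (\<lambda>i. s k (v i))"
proof -
  have mem: "of_int (a i j) * v i * v j \<in> K" if "i \<in> {..<r}" "j \<in> {i..<r}" for i j
    using that by (intro mult_K Rats_K[OF Rats_of_int] v) auto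
  have "s k (qf_eval r a v) = (\<Sum>i<r. s k (\<Sum>j\<in>{i..<r}. of_int (a i j) * v i * v j))"
    unfolding qf_eval_def by (rule conjunct2[OF s_sum], rule conjunct1[OF s_sum], rule mem)
  also have "\<dots> = (\<Sum>i<r. \<Sum>j\<in>{i..<r}. s k (of_int (a i j) * v i * v j))"
    by (intro sum.cong refl conjunct2[OF s_sum] mem)
  also have "\<dots> = qf_eval r a (\<lambda>i. s k (v i))"
    unfolding qf_eval_def using v
    by (intro sum.cong refl) (simp add: s_mult mult_K Rats_K s_Rats)
  finally show ?thesis .
qed

text \<open>With \<open>D = 4 C A - B\<^sup>2\<close> one has
  \<open>12 C tr \<alpha> = (2 C tr \<psi> + 3 B)\<^sup>2 + 8 C\<^sup>2 q \<psi> + 9 D\<close>. For \<open>C = 1\<close>, since \<open>D\<close> is 0 or 3 modulo 4,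
  either \<open>D \<ge> 3\<close> or \<open>\<alpha>\<close> is the square of \<open>\<psi> + B/2\<close>.\<close>

lemma trace_binary_form:
  fixes A B C :: int
  assumes \<psi>: "\<psi> \<in> OK" "m \<le> q \<psi>" "7 \<le> m"
    and form: "C \<ge> 1" "B\<^sup>2 \<le> 4 * C * A"
    and \<alpha>: "\<alpha> = of_int C * \<psi>\<^sup>2 + of_int B * \<psi> + of_int A"
  shows "(\<exists>x\<in>OK. \<alpha> = x\<^sup>2) \<and> 2 * m \<le> 3 * tr \<alpha> \<or> 2 * m + 27/4 \<le> 3 * tr \<alpha>"
proof -
  define D where "D = 4 * C * A - B\<^sup>2"
  have s\<alpha>: "s k \<alpha> = of_int C * (s k \<psi>)\<^sup>2 + of_int B * s k \<psi> + of_int A" for k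
    unfolding \<alpha> using O_K[OF \<psi>(1)]
    by (simp add: s_add s_mult s_power s_Rats add_K mult_K power_K Rats_K)
  have "12 * of_int C * tr \<alpha> = (2 * of_int C * tr \<psi> + 3 * of_int B)\<^sup>2 + 8 * (of_int C)\<^sup>2 * q \<psi> + 9 * of_int D"
    unfolding tr_def q_def D_def s\<alpha>
    using sum_quadratic_values[of "of_int C" "s 0 \<psi>" "of_int B" "of_int A" "s 1 \<psi>" "s 2 \<psi>"] by simp
  hence bound: "8 * (of_int C)\<^sup>2 * q \<psi> + 9 * of_int D \<le> 12 * of_int C * tr \<alpha>"
    by simp
  have "D \<ge> 0" using form by (simp add: D_def)
  show ?thesis
  proof (cases "C = 1")
    case False
    hence C: "real_of_int C \<ge> 2" using form(1) by linarith
    have "real_of_int D \<ge> 0" using \<open>D \<ge> 0\<close> by simp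
    moreover have "4 * of_int C * (2 * of_int C * q \<psi>) = 8 * (of_int C)\<^sup>2 * q \<psi>"
      by (simp add: power2_eq_square)
    moreover have "4 * of_int C * (3 * tr \<alpha>) = 12 * of_int C * tr \<alpha>" by simp
    ultimately have "4 * of_int C * (2 * of_int C * q \<psi>) \<le> 4 * of_int C * (3 * tr \<alpha>)"
      using bound by linarith
    hence "2 * of_int C * q \<psi> \<le> 3 * tr \<alpha>" using C by simp
    \<comment> \<open>A leading coefficient of at least 2 already doubles the bound, and 4 m >= 2 m
      + 27/4 for m >= 7.\<close>
    moreover have "4 * m \<le> 2 * of_int C * q \<psi>" using C \<psi> by (intro mult_mono) auto
    ultimately have "4 * m \<le> 3 * tr \<alpha>" by linarith
    thus ?thesis using \<psi> by simp
  next
    case True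
    hence bound': "2 * m + 9/4 * of_int D \<le> 3 * tr \<alpha>"
      using bound \<psi>(2) by simp
    show ?thesis
    proof (cases "D \<ge> 3")
      case True
      hence "real_of_int D \<ge> 3" by simp
      thus ?thesis using bound' by linarith
    next
      case False
      have "even B"
      proof (rule ccontr)
        assume "odd B"
        then obtain k where "B = 2 * k + 1" by (elim oddE)
        hence "D = 4 * (A - k\<^sup>2 - k) - 1"
          using \<open>C = 1\<close> by (simp add: D_def power2_eq_square algebra_simps)
        thus False using False \<open>D \<ge> 0\<close> by presburger
      qed
      then obtain k where k: "B = 2 * k" by (elim evenE)
      have "D = 4 * (A - k\<^sup>2)" using \<open>C = 1\<close> k by (simp add: D_def power2_eq_square)
      hence "A = k\<^sup>2" using False \<open>D \<ge> 0\<close> by presburger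
      hence "\<alpha> = (\<psi> + of_int k)\<^sup>2"
        unfolding \<alpha> using k \<open>C = 1\<close> by (simp add: power2_eq_square algebra_simps)
      moreover have "\<psi> + of_int k \<in> OK" using \<psi>(1) by (intro add_O Ints_O[OF Ints_of_int])
      moreover have "2 * m \<le> 3 * tr \<alpha>" using bound' \<open>D \<ge> 0\<close> 
        by (smt (verit) divide_nonneg_nonneg mult_nonneg_nonneg of_int_0_le_iff)
      ultimately show ?thesis by blast
    qed
  qed
qed

text \<open>Restricting Q to the plane of w and w0 gives a binary form with value \<alpha> at
  (\<psi>, 1). That \<alpha> is not an integer forces both w and \<psi> to be nontrivial, which
  releases the conditional bound on q \<psi>.\<close>

lemma trace_represented_rank_one:
  assumes "Z_form r a" and v: "\<And>i. i < r \<Longrightarrow> v i = of_int (w0 i) + of_int (w i) * \<psi>"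
    and \<psi>: "\<psi> \<in> OK" "\<psi> \<notin> \<int> \<Longrightarrow> m \<le> q \<psi>" "7 \<le> m"
    and \<alpha>: "\<alpha> = qf_eval r a v" "\<alpha> \<notin> \<int>"
  shows "(\<exists>x\<in>OK. \<alpha> = x\<^sup>2) \<and> 2 * m \<le> 3 * tr \<alpha> \<or> 2 * m + 27/4 \<le> 3 * tr \<alpha>"
proof -
  let ?U = "\<lambda>i. of_int (w0 i) :: real" and ?W = "\<lambda>i. of_int (w i) :: real"
  have nontriv: "\<exists>i<r. v i \<notin> \<int>" using \<alpha> qf_eval_Ints[of r v a] by blast
  have "\<psi> \<notin> \<int>" using nontriv v by auto
  have "\<exists>i<r. ?W i \<noteq> 0"
  proof (rule ccontr)
    assume "\<not> ?thesis"
    thus False using nontriv v by auto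
  qed
  hence ge1: "qf_eval r a ?W \<ge> 1" by (intro Z_form_ge_1 assms) auto
  obtain A B C where ABC: "qf_eval r a ?U = of_int A" "qf_polar r a ?W ?U = of_int B"
      "qf_eval r a ?W = of_int C"
    using qf_eval_Ints[of r ?U a] qf_eval_Ints[of r ?W a] qf_polar_Ints[of r ?W ?U a]
    by (auto elim!: Ints_cases)
  have "\<alpha> = qf_eval r a (\<lambda>i. \<psi> * ?W i + 1 * ?U i)"
    unfolding \<alpha>(1) by (intro qf_eval_cong) (simp add: v mult.commute)
  also have "\<dots> = of_int C * \<psi>\<^sup>2 + of_int B * \<psi> + of_int A"
    unfolding qf_eval_comb2 ABC by (simp add: mult_ac)
  finally have \<alpha>_eq: "\<alpha> = of_int C * \<psi>\<^sup>2 + of_int B * \<psi> + of_int A" .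
  have "real_of_int (B\<^sup>2) \<le> real_of_int (4 * C * A)"
    using Z_form_discriminant[OF assms(1), of ?W ?U] by (simp add: ABC)
  hence "B\<^sup>2 \<le> 4 * C * A" by (simp only: of_int_le_iff)
  moreover have "C \<ge> 1" using ge1 ABC by simp
  ultimately show ?thesis
    using trace_binary_form[OF \<psi>(1) \<psi>(2)[OF \<open>\<psi> \<notin> \<int>\<close>] \<psi>(3) _ _ \<alpha>_eq] by blast
qed

text \<open>The bound needs Q >= 1 on w1, w2 and w1 +- w2. If one of these four vectors vanishes,
  all coordinates lie in Z + Z \<psi> with \<psi> one of y, x, x + y, y - x, and the rank one bound
  applies.\<close>

lemma trace_represented:
  assumes "Z_form r a" and v: "\<And>i. i < r \<Longrightarrow> v i \<in> OK"
    and \<alpha>: "\<alpha> = qf_eval r a v" "\<alpha> \<notin> \<int>"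
    and xy: "x \<in> OK" "y \<in> OK" "x \<notin> \<int>" and min: "\<And>z. \<lbrakk>z \<in> OK; z \<notin> \<int>\<rbrakk> \<Longrightarrow> q x \<le> q z"
    and polar: "\<bar>qpolar x y\<bar> \<le> q x"
    and basis: "\<And>z. z \<in> OK \<Longrightarrow> \<exists>a b c :: int. z = of_int a + of_int b * x + of_int c * y"
    and "7 \<le> q x"
  shows "(\<exists>z\<in>OK. \<alpha> = z\<^sup>2) \<and> 2 * q x \<le> 3 * tr \<alpha> \<or> 2 * q x + 27/4 \<le> 3 * tr \<alpha>"
proof -
  have "\<forall>i\<in>{..<r}. \<exists>a b c :: int. v i = of_int a + of_int b * x + of_int c * y"
    using v basis by blast
  then obtain w0 w1 w2 :: "nat \<Rightarrow> int"
    where w: "\<And>i. i < r \<Longrightarrow> v i = of_int (w0 i) + of_int (w1 i) * x + of_int (w2 i) * y"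
    by (metis lessThan_iff)
  have rank_one: ?thesis if "\<psi> \<in> OK" "\<And>i. i < r \<Longrightarrow> v i = of_int (w0 i) + of_int (u i) * \<psi>" for \<psi> u
    by (rule trace_represented_rank_one[OF assms(1) that(2,1) min[OF that(1)] assms(11) \<alpha>])
  let ?W0 = "\<lambda>i. of_int (w0 i) :: real" and ?W1 = "\<lambda>i. of_int (w1 i) :: real"
    and ?W2 = "\<lambda>i. of_int (w2 i) :: real"
  consider "\<forall>i<r. w1 i = 0" | "\<forall>i<r. w2 i = 0" | "\<forall>i<r. w1 i = w2 i" | "\<forall>i<r. w1 i = - w2 i"
    | "\<exists>i<r. w1 i \<noteq> 0" "\<exists>i<r. w2 i \<noteq> 0" "\<exists>i<r. w1 i \<noteq> w2 i" "\<exists>i<r. w1 i \<noteq> - w2 i"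
    by blast
  thus ?thesis
  proof cases
    case 1
    thus ?thesis using xy w by (intro rank_one[of y w2]) auto
  next
    case 2
    thus ?thesis using xy w by (intro rank_one[of x w1]) auto
  next
    case 3
    thus ?thesis using xy w by (intro rank_one[of "x + y" w2]) (auto intro: add_O simp: algebra_simps)
  next
    case 4
    thus ?thesis using xy w by (intro rank_one[of "y - x" w2]) (auto intro: diff_O simp: algebra_simps)
  next
    case 5
    hence neq: "\<exists>i<r. ?W1 i \<noteq> 0" "\<exists>i<r. ?W2 i \<noteq> 0" "\<exists>i<r. ?W1 i \<noteq> ?W2 i" "\<exists>i<r. ?W1 i \<noteq> - ?W2 i"
      by (simp_all flip: of_int_minus)
    define A1 A2 B where "A1 = qf_eval r a ?W1" and "A2 = qf_eval r a ?W2" and "B = qf_polar r a ?W1 ?W2"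
    have A: "A1 \<ge> 1" "A2 \<ge> 1" unfolding A1_def A2_def by (intro Z_form_ge_1 assms(1) neq; simp)+
    have B: "\<bar>B\<bar> \<le> A1 + A2 - 1"
      unfolding A1_def A2_def B_def by (rule Z_form_polar_bound) (use assms(1) neq in auto)
    \<comment> \<open>If y were an integer, the basis property would place the whole ring in Z + Z
      x, contradicting rational independence.\<close>
    have qy: "q x \<le> q y"
    proof (cases "y \<in> \<int>")
      case True
      then obtain n where n: "y = of_int n" by (elim Ints_cases)
      obtain z where "z \<in> OK" "\<forall>a\<in>\<rat>. \<forall>b\<in>\<rat>. z \<noteq> a + b * x"
        using exists_rationally_independent[of x] xy O_K Rats_O by blast
      thus ?thesis
        using basis[of z] unfolding n by (metis Rats_of_int add.assoc add.commute of_int_add of_int_mult)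
    qed (use min xy in blast)
    have sv: "s k \<alpha> = qf_eval r a (\<lambda>i. 1 * ?W0 i + s k x * ?W1 i + s k y * ?W2 i)" for k
    proof -
      have "s k \<alpha> = qf_eval r a (\<lambda>i. s k (v i))"
        unfolding \<alpha>(1) using v O_K by (intro s_qf_eval) blast
      also have "\<dots> = qf_eval r a (\<lambda>i. 1 * ?W0 i + s k x * ?W1 i + s k y * ?W2 i)"
        using xy O_K w
        by (intro qf_eval_cong) (simp add: s_add s_mult s_Rats add_K mult_K Rats_K)
      finally show ?thesis .
    qed
    \<comment> \<open>The first term is Q at the sum of the conjugate vectors; the others collect Q
      over their pairwise differences, with \<open>w0\<close> gone.\<close>
    have "3 * tr \<alpha> = qf_eval r a (\<lambda>i. 3 * ?W0 i + tr x * ?W1 i + tr y * ?W2 i)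
        + 2 * A1 * q x + 2 * A2 * q y + B * qpolar x y"
      unfolding tr_def sv qf_eval_comb q_def qpolar_def A1_def A2_def B_def
      by (simp add: power2_eq_square field_simps)
    hence "2 * A1 * q x + 2 * A2 * q y + B * qpolar x y \<le> 3 * tr \<alpha>"
      using Z_form_nonneg[OF assms(1)] by simp
    moreover have "\<bar>B * qpolar x y\<bar> \<le> (A1 + A2 - 1) * q x"
      unfolding abs_mult using B polar A by (intro mult_mono) auto
    moreover have "2 * A2 * q x \<le> 2 * A2 * q y" using A qy by (intro mult_left_mono) auto
    moreover have "(A1 + A2 + 1) * q x = 2 * A1 * q x + 2 * A2 * q x - (A1 + A2 - 1) * q x"
      by (simp add: algebra_simps)
    \<comment> \<open>The reduced polar form costs at most A1 + A2 - 1 of the 2 A1 + 2 A2 copies of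
      \<open>q x\<close>. At least three remain, and 3 m >= 2 m + 27/4 for m >= 7.\<close>
    ultimately have "(A1 + A2 + 1) * q x \<le> 3 * tr \<alpha>" by linarith
    moreover have "3 * q x \<le> (A1 + A2 + 1) * q x"
      using A q_nonneg[of x] by (intro mult_right_mono) auto
    ultimately show ?thesis using assms(11) by linarith
  qed
qed

end

section \<open>The field of discriminant 49\<close>

text \<open>The angle 2 pi / 7 satisfies cos 4x = cos 3x. In terms of c this is a quartic whose
  factor c - 2 belongs to x = 0.\<close>

lemma cos_two_pi_seventh:
  defines "c \<equiv> 2 * cos (2 * pi / 7)"
  shows "c ^ 3 + c\<^sup>2 - 2 * c - 1 = 0"
proof -
  define u where "u = cos (2 * pi / 7)"
  have "cos (2 * (2 * (2 * pi / 7))) = cos (2 * pi - 3 * (2 * pi / 7))" by (simp add: field_simps)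
  also have "\<dots> = cos (3 * (2 * pi / 7))" by (metis cos_2pi_minus)
  also have "\<dots> = 4 * u ^ 3 - 3 * u" unfolding u_def by (rule cos_treble_cos)
  also have "cos (2 * (2 * (2 * pi / 7))) = 2 * (2 * u\<^sup>2 - 1)\<^sup>2 - 1"
    unfolding u_def by (subst cos_double_cos, subst cos_double_cos) simp
  finally have "(c - 2) * (c ^ 3 + c\<^sup>2 - 2 * c - 1) = 0"
    unfolding c_def u_def[symmetric] by (simp add: power2_eq_square power3_eq_cube algebra_simps)
  moreover have "cos (2 * pi / 7) < cos 0"
    by (rule cos_monotone_0_pi) (use pi_gt_zero in auto)
  ultimately show ?thesis by (simp add: c_def)
qed

context cubic_field
begin

lemma rat_adjoin_subset:
  assumes "c \<in> K"
  shows "rat_adjoin c \<subseteq> K"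
proof -
  have "poly (map_poly of_rat g) c \<in> K" for g :: "rat poly"
    using assms by (induction g) (auto simp: map_poly_pCons intro!: add_K mult_K intro: Rats_K)
  thus ?thesis by (auto simp: rat_adjoin_def)
qed

lemma eq_rat_adjoin_seventh:
  assumes "c \<in> K" and c: "c ^ 3 + c\<^sup>2 - 2 * c - 1 = 0"
  shows "K = rat_adjoin c"
proof
  show "rat_adjoin c \<subseteq> K" by (rule rat_adjoin_subset) fact
  have "c \<notin> \<rat>"
  proof
    assume "c \<in> \<rat>"
    moreover have "algebraic_int c"
      by (rule algebraic_int.intros[of "[:-1, -2, 1, 1:]"])
        (use c in \<open>auto simp: coeff_pCons power2_eq_square power3_eq_cube algebra_simps split: nat.splits\<close>)
    ultimately obtain n where n: "c = of_int n"
      using rational_algebraic_int_is_int by (metis Ints_cases)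
    have "real_of_int (n ^ 3 + n\<^sup>2 - 2 * n - 1) = 0" using c n by simp
    hence "n * (n\<^sup>2 + n - 2) = 1" unfolding of_int_eq_0_iff 
      by (simp add: power2_eq_square power3_eq_cube algebra_simps)
    hence "n dvd 1" by (metis dvd_triv_left)
    hence "n = 1 \<or> n = -1" by auto
    thus False using \<open>n * (n\<^sup>2 + n - 2) = 1\<close> by auto
  qed
  have indep: "c\<^sup>2 \<noteq> a + b * c" if ab: "a \<in> \<rat>" "b \<in> \<rat>" for a b
  proof
    assume sq: "c\<^sup>2 = a + b * c"
    have "c ^ 3 = c * c\<^sup>2" by (simp add: power2_eq_square power3_eq_cube)
    also have "\<dots> = a * c + b * c\<^sup>2"
      by (subst (1) sq) (simp add: power2_eq_square algebra_simps)
    finally have "a * c + b * c\<^sup>2 + c\<^sup>2 - 2 * c - 1 = 0" using c by simp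
    hence lin: "(a + b\<^sup>2 + b - 2) * c = - (a * b + a - 1)"
      unfolding sq by (simp add: power2_eq_square algebra_simps)
    have a: "a + b\<^sup>2 + b - 2 = 0"
    proof (rule ccontr)
      assume "a + b\<^sup>2 + b - 2 \<noteq> 0"
      hence "c = - (a * b + a - 1) / (a + b\<^sup>2 + b - 2)" using lin by (simp add: field_simps)
      moreover have "\<dots> \<in> \<rat>" using ab by simp
      ultimately show False using \<open>c \<notin> \<rat>\<close> by metis
    qed
    hence "a * b + a - 1 = 0" using lin by simp
    moreover have "a = 2 - b - b\<^sup>2" using a by simp
    \<comment> \<open>A quadratic factor X^2 - b X - a leaves the cofactor X + 1 + b; this equation
      says that -(1 + b) is a rational root of the cubic.\<close>
    ultimately have b: "b ^ 3 + 2 * b\<^sup>2 - b - 1 = 0"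
      by (simp add: power2_eq_square power3_eq_cube algebra_simps)
    have "algebraic_int b"
      by (rule algebraic_int.intros[of "[:-1, -1, 2, 1:]"])
        (use b in \<open>auto simp: coeff_pCons power2_eq_square power3_eq_cube algebra_simps split: nat.splits\<close>)
    then obtain n where n: "b = of_int n"
      using rational_algebraic_int_is_int ab(2) by (metis Ints_cases)
    have "real_of_int (n ^ 3 + 2 * n\<^sup>2 - n - 1) = 0" using b n by simp
    hence *: "n * (n\<^sup>2 + 2 * n - 1) = 1" unfolding of_int_eq_0_iff 
      by (simp add: power2_eq_square power3_eq_cube algebra_simps)
    hence "n dvd 1" by (metis dvd_triv_left)
    hence "n = 1 \<or> n = -1" by auto
    thus False using * by auto
  qed
  show "K \<subseteq> rat_adjoin c"
  proof
    fix z assume "z \<in> K"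
    then obtain a b d where "a \<in> \<rat>" "b \<in> \<rat>" "d \<in> \<rat>" and z: "z = a + b * c + d * c\<^sup>2"
      using rational_span[OF assms(1) power_K[OF assms(1)] \<open>c \<notin> \<rat>\<close> indep, of z] by metis
    then obtain a' b' d' where "a = of_rat a'" "b = of_rat b'" "d = of_rat d'"
      by (auto elim!: Rats_cases)
    hence "z = poly (map_poly of_rat [:a', b', d':]) c"
      unfolding z by (simp add: of_rat_hom.map_poly_pCons_hom power2_eq_square algebra_simps)
    thus "z \<in> rat_adjoin c" unfolding rat_adjoin_def by blast
  qed
qed

text \<open>Here -x is a root of the cubic of c. The field of c is Galois, with u -> u^2 - 2
  permuting the roots c, c^2 - 2, 1 - c - c^2 cyclically, so c can be recovered from any of them and
  equality of subsets of the reals is the right exception.\<close>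

lemma eq_rat_adjoin_cos_seventh:
  assumes "x \<in> OK" "tr x = 1" "e2 x = -2" "nm x = -1"
  shows "K = rat_adjoin (2 * cos (2 * pi / 7))"
proof -
  define c where "c = 2 * cos (2 * pi / 7)"
  have c: "c ^ 3 + c\<^sup>2 - 2 * c - 1 = 0" unfolding c_def by (rule cos_two_pi_seventh)
  define y where "y = - x"
  have xK: "x \<in> K" using assms(1) by (rule O_K)
  have yK: "y \<in> K" unfolding y_def using xK by (rule uminus_K)
  have "s 0 y ^ 3 + (s 0 y)\<^sup>2 - 2 * s 0 y - 1 = 0"
  proof -
    define a b d where "a = s 0 x" and "b = s 1 x" and "d = s 2 x"
    have "a ^ 3 - (a + b + d) * a\<^sup>2 + (a * b + b * d + d * a) * a - a * b * d = 0"
      by (simp add: power2_eq_square power3_eq_cube algebra_simps)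
    hence "a ^ 3 - a\<^sup>2 - 2 * a + 1 = 0"
      using assms(2-4) unfolding tr_def e2_def nm_def a_def b_def d_def by simp
    thus ?thesis unfolding y_def s_uminus[OF xK] a_def by simp
  qed
  moreover have "s 0 (y ^ 3 + y\<^sup>2 - 2 * y - 1) = s 0 y ^ 3 + (s 0 y)\<^sup>2 - 2 * s 0 y - 1"
    by (simp add: yK s_diff s_add s_mult s_power s_Rats power_K add_K mult_K diff_K Rats_K)
  ultimately have "y ^ 3 + y\<^sup>2 - 2 * y - 1 = 0"
    using s_inj[of "y ^ 3 + y\<^sup>2 - 2 * y - 1" 0]
    by (simp add: diff_K add_K mult_K power_K yK Rats_K)
  moreover have "y ^ 3 + y\<^sup>2 - 2 * y - 1 = (y - c) * (y - (c\<^sup>2 - 2)) * (y - (1 - c - c\<^sup>2))"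
  proof -
    have "(y - c) * (y - (c\<^sup>2 - 2)) * (y - (1 - c - c\<^sup>2)) - (y ^ 3 + y\<^sup>2 - 2 * y - 1) =
      (c ^ 3 + c\<^sup>2 - 2 * c - 1) * (c\<^sup>2 - 1 - c * y)"
      by (simp add: power2_eq_square power3_eq_cube algebra_simps)
    thus ?thesis using c by simp
  qed
  ultimately consider "y = c" | "y = c\<^sup>2 - 2" | "y = 1 - c - c\<^sup>2" by auto
  hence "c \<in> K"
  proof cases
    case 1
    thus ?thesis using yK by simp
  next
    case 2
    have "(1 - c - c\<^sup>2)\<^sup>2 - 2 - c = (c + 1) * (c ^ 3 + c\<^sup>2 - 2 * c - 1)"
      by (simp add: power2_eq_square power3_eq_cube algebra_simps)
    moreover have "y\<^sup>2 - 2 - (1 - c - c\<^sup>2) = (c - 1) * (c ^ 3 + c\<^sup>2 - 2 * c - 1)"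
      unfolding 2 by (simp add: power2_eq_square power3_eq_cube algebra_simps)
    ultimately have y2: "y\<^sup>2 - 2 = 1 - c - c\<^sup>2" and "(1 - c - c\<^sup>2)\<^sup>2 - 2 = c" using c by simp_all
    hence "(y\<^sup>2 - 2)\<^sup>2 - 2 = c" unfolding y2 by simp
    thus ?thesis using yK by (metis Rats_K Rats_number_of diff_K power_K)
  next
    case 3
    have "y\<^sup>2 - 2 - c = (c + 1) * (c ^ 3 + c\<^sup>2 - 2 * c - 1)"
      unfolding 3 by (simp add: power2_eq_square power3_eq_cube algebra_simps)
    hence "y\<^sup>2 - 2 = c" using c by simp
    thus ?thesis using yK by (metis Rats_K Rats_number_of diff_K power_K)
  qed
  thus ?thesis using eq_rat_adjoin_seventh c unfolding c_def by blast
qed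

end

section \<open>Nonexistence of universal forms\<close>

context cubic_field
begin

text \<open>Adding n changes the trace by 3 n and leaves q alone; a sign change turns residue 2
  modulo 3 into residue 1.\<close>

lemma exists_trace_normalized:
  assumes "x \<in> OK" "x \<notin> \<int>"
  obtains z where "z \<in> OK" "z \<notin> \<int>" "q z = q x" "tr z = 0 \<or> tr z = 1"
proof -
  note result = that
  obtain T :: int where T: "tr x = of_int T" using tr_Ints[OF assms(1)] by (elim Ints_cases)
  have s_shift: "s i (e * x + of_int n) = e * s i x + of_int n" if "e \<in> \<rat>" for i e n
    using that O_K[OF assms(1)] by (simp add: s_add s_mult s_Rats mult_K Rats_K)
  have ok: thesis if e: "e = 1 \<or> e = -1" and "e * of_int T + 3 * of_int n \<in> {0, 1}" for e :: real and n :: int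
  proof (rule result[of "e * x + of_int n"])
    have "e \<in> \<int>" using e by auto
    thus "e * x + of_int n \<in> OK" by (intro add_O mult_O Ints_O assms(1)) auto
    show "e * x + of_int n \<notin> \<int>"
    proof
      assume "e * x + of_int n \<in> \<int>"
      hence "e * (e * x + of_int n - of_int n) \<in> \<int>" using \<open>e \<in> \<int>\<close> by (intro Ints_mult Ints_diff) auto
      thus False using e assms(2) by auto
    qed
    have "e \<in> \<rat>" using \<open>e \<in> \<int>\<close> Ints_subset_Rats by blast
    note ss = s_shift[OF this]
    show "q (e * x + of_int n) = q x"
      using q_comb[OF O_K[OF assms(1)] O_K[OF assms(1)] _ \<open>e \<in> \<rat>\<close>, of "of_int n" 0] e
      by (auto simp: add.commute)
    have "tr (e * x + of_int n) = e * tr x + 3 * of_int n" unfolding tr_def ss by (simp add: algebra_simps)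
    thus "tr (e * x + of_int n) = 0 \<or> tr (e * x + of_int n) = 1" using that(2) T by auto
  qed
  consider "T mod 3 = 0" | "T mod 3 = 1" | "T mod 3 = 2" by linarith
  thus thesis
  proof cases
    case 1
    then obtain n where "T = 3 * n" by auto
    thus thesis by (intro ok[of 1 "-n"]) auto
  next
    case 2
    hence "T = 3 * (T div 3) + 1" by (metis mult_div_mod_eq)
    then obtain n where "T = 3 * n + 1" by blast
    thus thesis by (intro ok[of 1 "-n"]) auto
  next
    case 3
    hence "T = 3 * (T div 3) + 2" by (metis mult_div_mod_eq)
    then obtain n where "T = 3 * n + 2" by blast
    thus thesis by (intro ok[of "-1" "n + 1"]) auto
  qed
qed

lemma no_universal_Z_form:
  assumes K: "K \<noteq> rat_adjoin (2 * cos (2 * pi / 7))" and Z: "Z_form r a" and univ: "universal_over K r a"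
  shows False
proof -
  obtain x y where xy: "x \<in> OK" "y \<in> OK" "x \<notin> \<int>" "\<And>z. \<lbrakk>z \<in> OK; z \<notin> \<int>\<rbrakk> \<Longrightarrow> q x \<le> q z"
      "\<bar>qpolar x y\<bar> \<le> q x"
      "\<And>z. z \<in> OK \<Longrightarrow> \<exists>a b c :: int. z = of_int a + of_int b * x + of_int c * y"
    using exists_reduced_basis by metis
  obtain z where z: "z \<in> OK" "z \<notin> \<int>" "q z = q x" "tr z = 0 \<or> tr z = 1"
    using exists_trace_normalized[OF xy(1,3)] by metis
  obtain A N C :: int where A: "tr z = of_int A" "e2 z = - of_int N" "nm z = of_int C"
  proof -
    obtain a b c :: int where "tr z = of_int a" "e2 z = of_int b" "nm z = of_int c"
      using tr_Ints[OF z(1)] e2_Ints[OF z(1)] nm_Ints[OF z(1)] by (elim Ints_cases)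
    thus thesis using that[of a "- b" c] by simp
  qed
  have nonint: "s i z \<notin> \<int>" for i
  proof
    assume "s i z \<in> \<int>"
    then obtain n where "s i z = of_int n" by (elim Ints_cases)
    hence "z = of_int n"
      using s_eq_imp_eq[of z "of_int n" i] O_K[OF z(1)] by (simp add: s_Rats Rats_K)
    thus False using z(2) by simp
  qed
  interpret roots: cubic_roots "s 0 z" "s 1 z" "s 2 z" A N C
    by unfold_locales (use A nonint in \<open>simp_all add: tr_def e2_def nm_def\<close>)
  have qz: "q x = of_int (A\<^sup>2 + 3 * N)" using z(3) q_eq[of z] A by simp
  have "A \<in> {0, 1}" using z(4) A by auto
  moreover have "\<not> (A = 1 \<and> N = 2 \<and> C = -1)"
    using eq_rat_adjoin_cos_seventh[OF z(1)] A K by auto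
  ultimately obtain \<epsilon> k where ge7: "7 \<le> A\<^sup>2 + 3 * N" and \<epsilon>: "\<epsilon> \<in> {1, -1}" and good: "roots.good_shift \<epsilon> k"
    using cubic_roots_good_shift[OF roots.cubic_roots_axioms] by blast
  define \<alpha> where "\<alpha> = \<epsilon> * z + of_int k"
  have \<epsilon>Z: "\<epsilon> \<in> \<int>" using \<epsilon> by auto
  have \<alpha>O: "\<alpha> \<in> OK" unfolding \<alpha>_def using \<epsilon>Z by (intro add_O mult_O Ints_O z(1)) auto
  have s\<alpha>: "s i \<alpha> = \<epsilon> * s i z + of_int k" for i
  proof -
    have "\<epsilon> \<in> \<rat>" using \<epsilon>Z Ints_subset_Rats by blast
    thus ?thesis unfolding \<alpha>_def using O_K[OF z(1)] by (simp add: s_add s_mult s_Rats mult_K Rats_K)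
  qed
  have "s 0 \<alpha> > 0" "s 1 \<alpha> > 0" "s 2 \<alpha> > 0"
    using good unfolding roots.good_shift_def s\<alpha> by auto
  hence pos: "s i \<alpha> > 0" if "i < 3" for i :: nat
    using that by (auto simp: numeral_3_eq_3 numeral_2_eq_2 less_Suc_eq One_nat_def)
  have "totally_positive K \<alpha>"
    unfolding totally_positive_def using O_K[OF \<alpha>O] embedding_eq pos by fastforce
  then obtain v where v: "\<And>i. i < r \<Longrightarrow> v i \<in> OK" "qf_eval r a v = \<alpha>"
    using univ \<alpha>O unfolding universal_over_def by blast
  have "\<alpha> \<notin> \<int>"
  proof
    assume "\<alpha> \<in> \<int>"
    hence "\<epsilon> * (\<alpha> - of_int k) \<in> \<int>" using \<epsilon>Z by (intro Ints_mult Ints_diff) auto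
    thus False using \<epsilon> z(2) by (auto simp: \<alpha>_def)
  qed
  moreover have "7 \<le> q x" unfolding qz using ge7 by (metis of_int_le_iff of_int_numeral)
  ultimately have rep: "(\<exists>w\<in>OK. \<alpha> = w\<^sup>2) \<and> 2 * q x \<le> 3 * tr \<alpha> \<or> 2 * q x + 27/4 \<le> 3 * tr \<alpha>"
    using trace_represented[OF Z v(1) v(2)[symmetric] _ xy] by blast
  have tr\<alpha>: "tr \<alpha> = \<epsilon> * of_int A + 3 * of_int k"
    unfolding tr_def s\<alpha> using roots.e1 by (simp add: algebra_simps flip: distrib_left)
  \<comment> \<open>The strict bound below 2 m contradicts both alternatives of \<open>rep\<close>.
    The weaker one leaves only the square, and the norm of a square is an integer square, unlike 3
    and 5.\<close>
  have "\<exists>w\<in>OK. \<alpha> = w\<^sup>2" "nm \<alpha> \<in> {3, 5}"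
    using rep good qz unfolding roots.good_shift_def tr\<alpha> nm_def s\<alpha> by auto
  then obtain w where w: "w \<in> OK" "\<alpha> = w\<^sup>2" by blast
  obtain n where n: "nm w = of_int n" using nm_Ints[OF w(1)] by (elim Ints_cases)
  have "nm \<alpha> = (nm w)\<^sup>2" unfolding w(2) nm_def using O_K[OF w(1)] by (simp add: s_power power_mult_distrib)
  hence "real_of_int (n\<^sup>2) = real_of_int 3 \<or> real_of_int (n\<^sup>2) = real_of_int 5"
    using \<open>nm \<alpha> \<in> {3, 5}\<close> n by simp
  hence n2: "n\<^sup>2 = 3 \<or> n\<^sup>2 = 5" by (simp only: of_int_eq_iff)
  have "\<bar>n\<bar> < 3" 
    by (rule power_less_imp_less_base[of _ 2]) (use n2 in auto)
  hence "n \<in> {-2, -1, 0, 1, 2}" by auto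
  thus False using n2 by auto
qed

end

theorem theorem4p1:
  fixes K :: "real set"
  assumes "totally_real_cubic_field K"
    and "K \<noteq> rat_adjoin (2 * cos (2 * pi / 7))"
  shows "\<not> (\<exists>r a. Z_form r a \<and> universal_over K r a)"
proof -
  obtain t s where "cubic_field K t s"
    using totally_real_cubic_field_cubic_field[OF assms(1)] by blast
  then interpret cubic_field K t s .
  show ?thesis using no_universal_Z_form[OF assms(2)] by blast
qed

end
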